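(* Suppose that, as $m\to\infty$, $f_1/m\to0$, $m^{-1}\mathbb E\mathsf M\to\bar\kappa_1\geq 0$ and $m^{-1}\mathbb E\mathsf S\to\bar s\geq 0$ with $\bar\kappa_1+\bar s>1$ (and $f_j/m\to\bar f_j\geq 0$ for each class $j=2,\dots,K$). Then, as $m\to\infty$, for every filament $i\in\{1,\dots,f\}$, $$\mathbb P[L_i\ge l]\to\bigl(\rho_i\,e^{\ell_{\mathsf M+\mathsf S}'(1)}\bigr)^l,\qquad l=0,1,2,\dots,$$ and $$m^{-1}M\to\bar\kappa_1\,e^{\ell_{\mathsf M+\mathsf S}'(1)}\quad\text{in probability},$$ where $\ell_{\mathsf M+\mathsf S}'(1)$ satisfies $$1+\Lambda_{\mathsf M+\mathsf S}'\bigl(-\ell_{\mathsf M+\mathsf S}'(1)\bigr)=0.$$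
   Context: Model. For each $m\in\mathbb N$ consider $m$ monomers and $f=f(m)\ge1$ filaments with dissociation constants $0<\kappa_1\le\kappa_2\le\dots\le\kappa_f$ (which may depend on $m$). There is a fixed number $K$ of filament classes: $\kappa_i\in\{\varkappa_1,\dots,\varkappa_K\}$ with $\varkappa_1<\dots<\varkappa_K$, and $f_j\ge1$ is the number of filaments $n$ with $\kappa_n=\varkappa_j$, so $f=\sum_{j=1}^K f_j$, $\kappa_1=\varkappa_1$, and $f_1$ is the number of filaments with the smallest dissociation constant. Set $\rho_i=\kappa_1/\kappa_i$ for a filament $i$ and $\varrho_j=\varkappa_1/\varkappa_j$ for a class $j$. The $\varkappa_j$ may vary with $m$, but the ratios $\varrho_1=1>\varrho_2>\dots>\varrho_K>0$ are fixed. Statements about "filament $i$" as $m\to\infty$ refer to an index $i=i(m)\le f(m)$ that belongs to the same class for all $m$, so that $\rho_i$ is constant. Stationary distribution. $(L_1,\dots,L_f)$ is a random vector of nonnegative integers with $$\mathbb P[L_1=l_1,\dots,L_f=l_f]=c_{m,f}^{-1}\,m!\,\frac{\kappa_1^{-l_1}\cdots\kappa_f^{-l_f}}{(m-l_1-\dots-l_f)!},\qquad l_1+\dots+l_f\le m,$$ where $c_{m,f}$ is the normalization constant, and $M=m-L_1-\dots-L_f$. Auxiliary variables. $\mathsf M$ is Poisson with mean $\kappa_1$; for $i>f_1$, $\mathsf L_i$ is geometric with $\mathbb P[\mathsf L_i\ge l]=\rho_i^l$, $l=0,1,\dots$; all are independent. $\mathsf S=\sum_{i>f_1}\mathsf L_i$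 ($\mathsf S\equiv0$ if $f_1=f$). All depend on $m$, which is suppressed. Rate function. With $\bar f_j=\lim f_j/m$, define for $\theta\ge0$ $$\Lambda_{\mathsf M+\mathsf S}(\theta)=\lim_{m\to\infty}\tfrac1m\log\mathbb E e^{-\theta(\mathsf M+\mathsf S)}=-\bar\kappa_1(1-e^{-\theta})+\sum_{j=2}^K\bar f_j\log\frac{1-\varrho_j}{1-\varrho_je^{-\theta}},$$ $$\ell_{\mathsf M+\mathsf S}(x)=\sup_{\theta\ge0}\{-\theta x-\Lambda_{\mathsf M+\mathsf S}(\theta)\},\qquad x\ge0.$$ *)

theory Defs
  imports "HOL-Probability.Probability"
begin

section \<open>Filaments with finitely many classes\<close>

definition class_size ::
  "(nat \<Rightarrow> nat) \<Rightarrow> (nat \<Rightarrow> nat \<Rightarrow> real) \<Rightarrow> (nat \<Rightarrow> nat \<Rightarrow> real) \<Rightarrow> nat \<Rightarrow> nat \<Rightarrow> nat" where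
  "class_size f \<kappa> varkappa m j = card {n \<in> {1..f m}. \<kappa> m n = varkappa m j}"

text \<open>
  Filaments are numbered \<open>1..f m\<close> and classes \<open>1..K\<close>; values at indices outside these ranges, and
  at \<open>m = 0\<close>, are irrelevant.
\<close>

locale filament_model =
  fixes K :: nat and f :: "nat \<Rightarrow> nat"
    and \<kappa> varkappa :: "nat \<Rightarrow> nat \<Rightarrow> real" and varrho :: "nat \<Rightarrow> real"
  assumes filaments: "m \<ge> 1 \<Longrightarrow> f m \<ge> 1"
    and kappa_pos: "m \<ge> 1 \<Longrightarrow> n \<in> {1..f m} \<Longrightarrow> 0 < \<kappa> m n"
    and kappa_mono: "m \<ge> 1 \<Longrightarrow> mono_on {1..f m} (\<kappa> m)"
    and classes: "m \<ge> 1 \<Longrightarrow> \<kappa> m ` {1..f m} \<subseteq> varkappa m ` {1..K}"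
    and varkappa_strict: "m \<ge> 1 \<Longrightarrow> strict_mono_on {1..K} (varkappa m)"
    and class_nonempty: "m \<ge> 1 \<Longrightarrow> j \<in> {1..K} \<Longrightarrow> class_size f \<kappa> varkappa m j \<ge> 1"
    and ratios: "m \<ge> 1 \<Longrightarrow> j \<in> {1..K} \<Longrightarrow> varkappa m 1 / varkappa m j = varrho j"

section \<open>Stationary distribution\<close>

definition weight :: "nat \<Rightarrow> nat \<Rightarrow> (nat \<Rightarrow> real) \<Rightarrow> (nat \<Rightarrow> nat) \<Rightarrow> real" where
  "weight m fm k l = fact m * (\<Prod>n=1..fm. inverse (k n) ^ l n) / fact (m - (\<Sum>n=1..fm. l n))"

definition normalization :: "nat \<Rightarrow> nat \<Rightarrow> (nat \<Rightarrow> real) \<Rightarrow> real" where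
  "normalization m fm k =
     (\<Sum>l | l \<in> {1..fm} \<rightarrow>\<^sub>E (UNIV :: nat set) \<and> (\<Sum>n=1..fm. l n) \<le> m. weight m fm k l)"

locale stationary_lengths = prob_space P
  for P :: "'a measure" +
  fixes m fm :: nat and k :: "nat \<Rightarrow> real" and L :: "nat \<Rightarrow> 'a \<Rightarrow> nat"
  assumes rv: "n \<in> {1..fm} \<Longrightarrow> random_variable (count_space UNIV) (L n)"
    and law: "(\<Sum>n=1..fm. l n) \<le> m \<Longrightarrow>
      prob {\<omega> \<in> space P. \<forall>n\<in>{1..fm}. L n \<omega> = l n} = weight m fm k l / normalization m fm k"

text \<open>
  The number of free monomers.  The subtraction is done in the reals; almost surely the lengths add
  up to at most \<open>m\<close>.
\<close>

definition monomers :: "nat \<Rightarrow> nat \<Rightarrow> (nat \<Rightarrow> 'a \<Rightarrow> nat) \<Rightarrow> 'a \<Rightarrow> real" where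
  "monomers m fm L \<omega> = real m - (\<Sum>n=1..fm. real (L n \<omega>))"

section \<open>Auxiliary variables\<close>

text \<open>
  \<open>AM\<close> is the Poisson variable, \<open>AL n\<close> with \<open>f1 < n \<le> fm\<close> are the geometric ones.  In the
  independence assumption the free index \<open>0\<close> is used for \<open>AM\<close>.
\<close>

locale auxiliary_variables = prob_space Q
  for Q :: "'b measure" +
  fixes fm f1 :: nat and k :: "nat \<Rightarrow> real" and AM :: "'b \<Rightarrow> nat" and AL :: "nat \<Rightarrow> 'b \<Rightarrow> nat"
  assumes indep: "indep_vars (\<lambda>_. count_space UNIV) (\<lambda>n. if n = 0 then AM else AL n)
                    (insert 0 {f1<..fm})"
    and poisson: "prob {\<omega> \<in> space Q. AM \<omega> = x} = pmf (poisson_pmf (k 1)) x"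
    and geometric: "n \<in> {f1<..fm} \<Longrightarrow> prob {\<omega> \<in> space Q. AL n \<omega> \<ge> x} = (k 1 / k n) ^ x"

definition aux_sum :: "nat \<Rightarrow> nat \<Rightarrow> (nat \<Rightarrow> 'b \<Rightarrow> nat) \<Rightarrow> 'b \<Rightarrow> real" where
  "aux_sum fm f1 AL \<omega> = (\<Sum>n\<in>{f1<..fm}. real (AL n \<omega>))"

section \<open>Rate function\<close>

definition log_laplace :: "(nat \<Rightarrow> 'b measure) \<Rightarrow> (nat \<Rightarrow> 'b \<Rightarrow> real) \<Rightarrow> real \<Rightarrow> real" where
  "log_laplace Q X \<theta> = lim (\<lambda>m. ln (\<integral>\<omega>. exp (- \<theta> * X m \<omega>) \<partial>Q m) / real m)"

text \<open>
  The supremum is taken in the reals.  For the limit \<open>\<Lambda>\<close> computed below, which is bounded below on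
  \<open>{0..}\<close>, the set is bounded above for every \<open>x \<ge> 0\<close>.
\<close>

definition rate_function :: "(real \<Rightarrow> real) \<Rightarrow> real \<Rightarrow> real" where
  "rate_function \<Lambda> x = (SUP \<theta>\<in>{0..}. - \<theta> * x - \<Lambda> \<theta>)"

section \<open>Closed form of the limiting log-Laplace transform\<close>

lemma (in prob_space) expectation_nat_sums:
  fixes X :: "'a \<Rightarrow> nat" and g :: "nat \<Rightarrow> real"
  assumes X [measurable]: "random_variable (count_space UNIV) X"
    and g: "\<And>n. g n \<ge> 0"
    and s: "(\<lambda>n. g n * prob {\<omega> \<in> space M. X \<omega> = n}) sums s"
  shows "integrable M (\<lambda>\<omega>. g (X \<omega>))" "expectation (\<lambda>\<omega>. g (X \<omega>)) = s"
proof -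
  have s0: "s \<ge> 0"
    using g by (intro sums_le[OF _ sums_zero s]) auto
  have eq: "ennreal (g (X \<omega>)) = (\<Sum>n. ennreal (g n) * indicator {\<omega> \<in> space M. X \<omega> = n} \<omega>)"
    if "\<omega> \<in> space M" for \<omega>
  proof -
    have "(\<Sum>n. ennreal (g n) * indicator {\<omega> \<in> space M. X \<omega> = n} \<omega>)
        = (\<Sum>n\<in>{X \<omega>}. ennreal (g n) * indicator {\<omega> \<in> space M. X \<omega> = n} \<omega>)"
      by (rule suminf_finite) (auto simp: indicator_def)
    with that show ?thesis by simp
  qed
  have "(\<integral>\<^sup>+\<omega>. ennreal (g (X \<omega>)) \<partial>M)
      = (\<integral>\<^sup>+\<omega>. (\<Sum>n. ennreal (g n) * indicator {\<omega> \<in> space M. X \<omega> = n} \<omega>) \<partial>M)"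
    by (rule nn_integral_cong) (rule eq)
  also have "\<dots> = (\<Sum>n. ennreal (g n) * emeasure M {\<omega> \<in> space M. X \<omega> = n})"
    by (subst nn_integral_suminf) (auto simp: nn_integral_cmult_indicator)
  also have "\<dots> = (\<Sum>n. ennreal (g n * prob {\<omega> \<in> space M. X \<omega> = n}))"
    by (simp add: emeasure_eq_measure ennreal_mult g)
  also have "\<dots> = ennreal s"
    using s g by (intro suminf_ennreal_eq) auto
  finally have nn: "(\<integral>\<^sup>+\<omega>. ennreal (g (X \<omega>)) \<partial>M) = ennreal s" .
  have "has_bochner_integral M (\<lambda>\<omega>. g (X \<omega>)) s"
    by (rule has_bochner_integral_nn_integral) (use nn s0 g in auto)
  then show "integrable M (\<lambda>\<omega>. g (X \<omega>))" "expectation (\<lambda>\<omega>. g (X \<omega>)) = s"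
    by (auto simp: has_bochner_integral_iff)
qed

lemma (in auxiliary_variables) laplace_poisson:
  assumes "k 1 > 0"
  shows "integrable Q (\<lambda>\<omega>. exp (- \<theta> * real (AM \<omega>)))"
    and "expectation (\<lambda>\<omega>. exp (- \<theta> * real (AM \<omega>))) = exp (- k 1 * (1 - exp (- \<theta>)))"
proof -
  have rv: "random_variable (count_space UNIV) AM"
    using indep unfolding indep_vars_def by (auto dest: bspec[of _ _ 0])
  have "(\<lambda>n. (exp (- \<theta>) * k 1) ^ n /\<^sub>R fact n) sums exp (exp (- \<theta>) * k 1)"
    by (rule exp_converges)
  from sums_mult[OF this, of "exp (- k 1)"]
  have "(\<lambda>n. exp (- \<theta> * real n) * prob {\<omega> \<in> space Q. AM \<omega> = n})
          sums (exp (- k 1) * exp (exp (- \<theta>) * k 1))"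
    using assms
    by (simp add: poisson power_mult_distrib divide_inverse mult_ac flip: exp_of_nat_mult)
  also have "exp (- k 1) * exp (exp (- \<theta>) * k 1) = exp (- k 1 * (1 - exp (- \<theta>)))"
    by (simp add: algebra_simps flip: exp_add)
  finally have s: "(\<lambda>n. exp (- \<theta> * real n) * prob {\<omega> \<in> space Q. AM \<omega> = n})
      sums exp (- k 1 * (1 - exp (- \<theta>)))" .
  show "integrable Q (\<lambda>\<omega>. exp (- \<theta> * real (AM \<omega>)))"
    and "expectation (\<lambda>\<omega>. exp (- \<theta> * real (AM \<omega>))) = exp (- k 1 * (1 - exp (- \<theta>)))"
    using expectation_nat_sums[OF rv _ s] by auto
qed

lemma (in auxiliary_variables) laplace_geometric:
  assumes n: "n \<in> {f1<..fm}" and r: "0 < k 1 / k n" "k 1 / k n < 1" and \<theta>: "\<theta> \<ge> 0"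
  shows "integrable Q (\<lambda>\<omega>. exp (- \<theta> * real (AL n \<omega>)))"
    and "expectation (\<lambda>\<omega>. exp (- \<theta> * real (AL n \<omega>)))
           = (1 - k 1 / k n) / (1 - k 1 / k n * exp (- \<theta>))"
proof -
  define \<rho> where "\<rho> = k 1 / k n"
  have rv [measurable]: "random_variable (count_space UNIV) (AL n)"
    using indep n unfolding indep_vars_def by (auto dest: bspec[of _ _ n])
  have point: "prob {\<omega> \<in> space Q. AL n \<omega> = x} = (1 - \<rho>) * \<rho> ^ x" for x
  proof -
    let ?A = "\<lambda>y. {\<omega> \<in> space Q. AL n \<omega> \<ge> y}"
    have A: "?A y \<in> events" for y
      by measurable
    have "{\<omega> \<in> space Q. AL n \<omega> = x} = ?A x - ?A (Suc x)"
      by auto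
    also have "prob \<dots> = prob (?A x) - prob (?A (Suc x))"
      by (rule finite_measure_Diff[OF A A]) auto
    finally have "prob {\<omega> \<in> space Q. AL n \<omega> = x} = prob (?A x) - prob (?A (Suc x))" .
    then show ?thesis
      unfolding geometric[OF n] \<rho>_def[symmetric] by (simp add: left_diff_distrib)
  qed
  have "exp (- \<theta>) \<le> 1" using \<theta> by simp
  then have "\<rho> * exp (- \<theta>) < 1"
    using r unfolding \<rho>_def[symmetric] by (smt (verit) mult_left_le)
  then have "(\<lambda>x. (\<rho> * exp (- \<theta>)) ^ x) sums (1 / (1 - \<rho> * exp (- \<theta>)))"
    using r unfolding \<rho>_def[symmetric] by (intro geometric_sums) simp
  from sums_mult[OF this, of "1 - \<rho>"]
  have s: "(\<lambda>x. exp (- \<theta> * real x) * prob {\<omega> \<in> space Q. AL n \<omega> = x})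
             sums ((1 - \<rho>) / (1 - \<rho> * exp (- \<theta>)))"
    by (simp add: point power_mult_distrib mult_ac flip: exp_of_nat_mult)
  show "integrable Q (\<lambda>\<omega>. exp (- \<theta> * real (AL n \<omega>)))"
    and "expectation (\<lambda>\<omega>. exp (- \<theta> * real (AL n \<omega>)))
           = (1 - k 1 / k n) / (1 - k 1 / k n * exp (- \<theta>))"
    using expectation_nat_sums[OF rv _ s] by (auto simp: \<rho>_def)
qed

lemma (in auxiliary_variables) ln_laplace:
  assumes "k 1 > 0" and r: "\<And>n. n \<in> {f1<..fm} \<Longrightarrow> 0 < k 1 / k n \<and> k 1 / k n < 1"
    and \<theta>: "\<theta> \<ge> 0"
  shows "ln (expectation (\<lambda>\<omega>. exp (- \<theta> * (real (AM \<omega>) + aux_sum fm f1 AL \<omega>))))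
       = - k 1 * (1 - exp (- \<theta>))
         + (\<Sum>n\<in>{f1<..fm}. ln ((1 - k 1 / k n) / (1 - k 1 / k n * exp (- \<theta>))))"
proof -
  define Y where "Y n = (\<lambda>\<omega>. exp (- \<theta> * real ((if n = 0 then AM else AL n) \<omega>)))" for n
  define I where "I = insert 0 {f1<..fm}"
  have "indep_vars (\<lambda>_. borel) Y I"
    unfolding Y_def I_def by (rule indep_vars_compose2[OF indep]) simp
  moreover have "integrable Q (Y n)" if "n \<in> I" for n
    using that assms laplace_poisson laplace_geometric unfolding Y_def I_def by (cases "n = 0") auto
  ultimately have "expectation (\<lambda>\<omega>. \<Prod>n\<in>I. Y n \<omega>) = (\<Prod>n\<in>I. expectation (Y n))"
    by (intro indep_vars_lebesgue_integral) (auto simp: I_def)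
  also have "\<dots> = expectation (Y 0) * (\<Prod>n\<in>{f1<..fm}. expectation (Y n))"
    by (simp add: I_def)
  also have "(\<Prod>n\<in>{f1<..fm}. expectation (Y n))
      = (\<Prod>n\<in>{f1<..fm}. (1 - k 1 / k n) / (1 - k 1 / k n * exp (- \<theta>)))"
  proof (rule prod.cong[OF refl])
    fix n assume "n \<in> {f1<..fm}"
    then show "expectation (Y n) = (1 - k 1 / k n) / (1 - k 1 / k n * exp (- \<theta>))"
      using laplace_geometric(2)[OF _ _ _ \<theta>, of n] r[of n] by (simp add: Y_def)
  qed
  also have "expectation (Y 0) = exp (- k 1 * (1 - exp (- \<theta>)))"
    using laplace_poisson(2)[OF assms(1)] by (simp add: Y_def)
  also have "(\<lambda>\<omega>. \<Prod>n\<in>I. Y n \<omega>) = (\<lambda>\<omega>. exp (- \<theta> * (real (AM \<omega>) + aux_sum fm f1 AL \<omega>)))"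
  proof
    fix \<omega>
    have "(\<Prod>n\<in>I. Y n \<omega>) = exp (\<Sum>n\<in>I. - \<theta> * real ((if n = 0 then AM else AL n) \<omega>))"
      unfolding Y_def by (rule exp_sum[symmetric]) (simp add: I_def)
    also have "(\<Sum>n\<in>I. - \<theta> * real ((if n = 0 then AM else AL n) \<omega>))
        = - \<theta> * (\<Sum>n\<in>I. real ((if n = 0 then AM else AL n) \<omega>))"
      by (rule sum_distrib_left[symmetric])
    also have "(\<Sum>n\<in>I. real ((if n = 0 then AM else AL n) \<omega>)) = real (AM \<omega>) + aux_sum fm f1 AL \<omega>"
      by (simp add: I_def aux_sum_def)
    finally show "(\<Prod>n\<in>I. Y n \<omega>) = exp (- \<theta> * (real (AM \<omega>) + aux_sum fm f1 AL \<omega>))" .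
  qed
  finally have E: "expectation (\<lambda>\<omega>. exp (- \<theta> * (real (AM \<omega>) + aux_sum fm f1 AL \<omega>)))
     = exp (- k 1 * (1 - exp (- \<theta>)))
       * (\<Prod>n\<in>{f1<..fm}. (1 - k 1 / k n) / (1 - k 1 / k n * exp (- \<theta>)))" .
  have pos: "(1 - k 1 / k n) / (1 - k 1 / k n * exp (- \<theta>)) > 0" if "n \<in> {f1<..fm}" for n
  proof -
    have "k 1 / k n * exp (- \<theta>) \<le> k 1 / k n"
      using r[OF that] \<theta> by (intro mult_left_le) auto
    then show ?thesis using r[OF that] by (intro divide_pos_pos) linarith+
  qed
  have "(\<Prod>n\<in>{f1<..fm}. (1 - k 1 / k n) / (1 - k 1 / k n * exp (- \<theta>))) > 0"
    by (rule prod_pos) (use pos in auto)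
  moreover have "ln (\<Prod>n\<in>{f1<..fm}. (1 - k 1 / k n) / (1 - k 1 / k n * exp (- \<theta>)))
      = (\<Sum>n\<in>{f1<..fm}. ln ((1 - k 1 / k n) / (1 - k 1 / k n * exp (- \<theta>))))"
    using less_imp_neq[OF pos, symmetric] by (intro ln_prod finite_greaterThanAtMost)
  ultimately show ?thesis
    unfolding E by (simp add: ln_mult_pos)
qed

context filament_model
begin

lemma K_pos: "K \<ge> 1"
  using classes[of 1] filaments[of 1] by fastforce

lemma varkappa_pos:
  assumes "m \<ge> 1" "j \<in> {1..K}"
  shows "varkappa m j > 0"
proof -
  have "{n \<in> {1..f m}. \<kappa> m n = varkappa m j} \<noteq> {}"
    using class_nonempty[OF assms] by (metis card.empty class_size_def not_one_le_zero)
  then obtain n where "n \<in> {1..f m}" "\<kappa> m n = varkappa m j" by blast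
  then show ?thesis using kappa_pos[OF assms(1)] by metis
qed

lemma varrho_bounds:
  assumes "j \<in> {2..K}"
  shows "0 < varrho j" "varrho j < 1"
proof -
  have "varkappa 1 1 < varkappa 1 j"
    using assms by (intro strict_mono_onD[OF varkappa_strict]) auto
  moreover have "varkappa 1 1 > 0" using varkappa_pos[of 1 1] K_pos by auto
  ultimately show "0 < varrho j" "varrho j < 1"
    using ratios[of 1 j] assms by (auto simp flip: ratios[of 1 j])
qed

lemma first_class:
  assumes m: "m \<ge> 1"
  shows "{n \<in> {1..f m}. \<kappa> m n = varkappa m 1} = {1..class_size f \<kappa> varkappa m 1}"
proof -
  define A where "A = {n \<in> {1..f m}. \<kappa> m n = varkappa m 1}"
  have low: "varkappa m 1 \<le> \<kappa> m n" if n: "n \<in> {1..f m}" for n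
  proof -
    obtain j where j: "j \<in> {1..K}" "\<kappa> m n = varkappa m j" using classes[OF m] n by blast
    then show ?thesis
      using strict_mono_onD[OF varkappa_strict[OF m], of 1 j] by (cases "j = 1") auto
  qed
  have down: "{1..n} \<subseteq> A" if n: "n \<in> A" for n
  proof
    fix n' assume n': "n' \<in> {1..n}"
    then have "\<kappa> m n' \<le> \<kappa> m n"
      using n by (intro mono_onD[OF kappa_mono[OF m]]) (auto simp: A_def)
    with low[of n'] n n' show "n' \<in> A" by (force simp: A_def)
  qed
  have fin: "finite A" by (simp add: A_def)
  have "A = {1..card A}"
  proof (cases "A = {}")
    case False
    then have "Max A \<in> A" using fin by simp
    then have "{1..Max A} = A" using down[of "Max A"] fin by (auto simp: A_def)
    then show ?thesis by (metis card_atLeastAtMost diff_Suc_1)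
  qed simp
  then show ?thesis by (simp add: A_def class_size_def)
qed

lemma kappa_first:
  assumes m: "m \<ge> 1"
  shows "\<kappa> m 1 = varkappa m 1"
proof -
  have "1 \<in> {1..class_size f \<kappa> varkappa m 1}"
    using class_nonempty[OF m, of 1] K_pos by simp
  then show ?thesis using first_class[OF m] by blast
qed

lemma other_classes:
  assumes m: "m \<ge> 1"
  shows "{class_size f \<kappa> varkappa m 1<..f m}
       = (\<Union>j\<in>{2..K}. {n \<in> {1..f m}. \<kappa> m n = varkappa m j})"
proof -
  have "{class_size f \<kappa> varkappa m 1<..f m} = {1..f m} - {1..class_size f \<kappa> varkappa m 1}"
    by auto
  also have "\<dots> = {n \<in> {1..f m}. \<kappa> m n \<noteq> varkappa m 1}"
    unfolding first_class[OF m, symmetric] by auto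
  also have "\<dots> = (\<Union>j\<in>{2..K}. {n \<in> {1..f m}. \<kappa> m n = varkappa m j})"
  proof (intro equalityI subsetI)
    fix n assume n: "n \<in> {n \<in> {1..f m}. \<kappa> m n \<noteq> varkappa m 1}"
    then obtain j where j: "j \<in> {1..K}" "\<kappa> m n = varkappa m j" using classes[OF m] by blast
    with n have "j \<noteq> 1" by auto
    with j n show "n \<in> (\<Union>j\<in>{2..K}. {n \<in> {1..f m}. \<kappa> m n = varkappa m j})" by force
  next
    fix n assume "n \<in> (\<Union>j\<in>{2..K}. {n \<in> {1..f m}. \<kappa> m n = varkappa m j})"
    then obtain j where "j \<in> {2..K}" "n \<in> {1..f m}" "\<kappa> m n = varkappa m j" by blast
    then show "n \<in> {n \<in> {1..f m}. \<kappa> m n \<noteq> varkappa m 1}"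
      using strict_mono_onD[OF varkappa_strict[OF m], of 1 j] by auto
  qed
  finally show ?thesis .
qed

lemma sum_other_classes:
  fixes g :: "real \<Rightarrow> real"
  assumes m: "m \<ge> 1"
  shows "(\<Sum>n\<in>{class_size f \<kappa> varkappa m 1<..f m}. g (\<kappa> m 1 / \<kappa> m n))
       = (\<Sum>j=2..K. real (class_size f \<kappa> varkappa m j) * g (varrho j))"
proof -
  have "(\<Sum>n\<in>{class_size f \<kappa> varkappa m 1<..f m}. g (\<kappa> m 1 / \<kappa> m n))
      = (\<Sum>j=2..K. \<Sum>n\<in>{n \<in> {1..f m}. \<kappa> m n = varkappa m j}. g (\<kappa> m 1 / \<kappa> m n))"
    unfolding other_classes[OF m]
  proof (rule sum.UNION_disjoint)
    have "inj_on (varkappa m) {1..K}"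
      using varkappa_strict[OF m] by (rule strict_mono_on_imp_inj_on)
    then show "\<forall>i\<in>{2..K}. \<forall>j\<in>{2..K}. i \<noteq> j \<longrightarrow>
        {n \<in> {1..f m}. \<kappa> m n = varkappa m i} \<inter> {n \<in> {1..f m}. \<kappa> m n = varkappa m j} = {}"
      unfolding inj_on_def disjoint_iff mem_Collect_eq
      by (metis atLeastAtMost_iff one_le_numeral order.trans)
  qed auto
  also have "\<dots> = (\<Sum>j=2..K. real (class_size f \<kappa> varkappa m j) * g (varrho j))"
  proof (rule sum.cong[OF refl])
    fix j assume j: "j \<in> {2..K}"
    have "(\<Sum>n\<in>{n \<in> {1..f m}. \<kappa> m n = varkappa m j}. g (\<kappa> m 1 / \<kappa> m n))
        = (\<Sum>n\<in>{n \<in> {1..f m}. \<kappa> m n = varkappa m j}. g (varrho j))"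
    proof (rule sum.cong[OF refl])
      fix n assume "n \<in> {n \<in> {1..f m}. \<kappa> m n = varkappa m j}"
      then have "\<kappa> m 1 / \<kappa> m n = varrho j"
        using ratios[OF m, of j] j kappa_first[OF m] by simp
      then show "g (\<kappa> m 1 / \<kappa> m n) = g (varrho j)" by simp
    qed
    then show "(\<Sum>n\<in>{n \<in> {1..f m}. \<kappa> m n = varkappa m j}. g (\<kappa> m 1 / \<kappa> m n))
        = real (class_size f \<kappa> varkappa m j) * g (varrho j)"
      by (simp add: class_size_def)
  qed
  finally show ?thesis .
qed

text \<open>
  In the hypothesis \<open>kap\<close>, \<open>\<kappa> m 1\<close> is the mean of the Poisson variable \<open>AM m\<close>.
\<close>

theorem log_laplace_closed_form:
  assumes aux: "\<And>m. m \<ge> 1 \<Longrightarrow>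
      auxiliary_variables (Q m) (f m) (class_size f \<kappa> varkappa m 1) (\<kappa> m) (AM m) (AL m)"
    and kap: "(\<lambda>m. \<kappa> m 1 / real m) \<longlonglongrightarrow> \<kappa>bar"
    and fbar: "\<And>j. j \<in> {2..K} \<Longrightarrow> (\<lambda>m. real (class_size f \<kappa> varkappa m j) / real m) \<longlonglongrightarrow> fbar j"
    and \<theta>: "\<theta> \<ge> 0"
  defines "X \<equiv> \<lambda>m \<omega>. real (AM m \<omega>) + aux_sum (f m) (class_size f \<kappa> varkappa m 1) (AL m) \<omega>"
    and "\<Lambda> \<equiv> - \<kappa>bar * (1 - exp (- \<theta>))
              + (\<Sum>j=2..K. fbar j * ln ((1 - varrho j) / (1 - varrho j * exp (- \<theta>))))"
  shows "(\<lambda>m. ln (\<integral>\<omega>. exp (- \<theta> * X m \<omega>) \<partial>Q m) / real m) \<longlonglongrightarrow> \<Lambda>"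
    and "log_laplace Q X \<theta> = \<Lambda>"
proof -
  let ?g = "\<lambda>r. ln ((1 - r) / (1 - r * exp (- \<theta>)))"
  have eq: "ln (\<integral>\<omega>. exp (- \<theta> * X m \<omega>) \<partial>Q m) / real m
      = - (\<kappa> m 1 / real m) * (1 - exp (- \<theta>))
        + (\<Sum>j=2..K. (real (class_size f \<kappa> varkappa m j) / real m) * ?g (varrho j))"
    if m: "m \<ge> 1" for m
  proof -
    interpret auxiliary_variables "Q m" "f m" "class_size f \<kappa> varkappa m 1" "\<kappa> m" "AM m" "AL m"
      by (rule aux[OF m])
    have "0 < \<kappa> m 1 / \<kappa> m n \<and> \<kappa> m 1 / \<kappa> m n < 1"
      if n: "n \<in> {class_size f \<kappa> varkappa m 1<..f m}" for n
    proof -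
      obtain j where j: "j \<in> {2..K}" "\<kappa> m n = varkappa m j"
        using n unfolding other_classes[OF m] by blast
      then have "\<kappa> m 1 / \<kappa> m n = varrho j"
        using ratios[OF m, of j] j(1) unfolding j(2) kappa_first[OF m] by simp
      then show ?thesis using varrho_bounds[OF j(1)] by simp
    qed
    moreover have "\<kappa> m 1 > 0" using kappa_pos[OF m] filaments[OF m] by auto
    ultimately have "ln (\<integral>\<omega>. exp (- \<theta> * X m \<omega>) \<partial>Q m)
        = - \<kappa> m 1 * (1 - exp (- \<theta>))
          + (\<Sum>n\<in>{class_size f \<kappa> varkappa m 1<..f m}. ?g (\<kappa> m 1 / \<kappa> m n))"
      unfolding X_def using \<theta> by (intro ln_laplace) auto
    also have "\<dots> = - \<kappa> m 1 * (1 - exp (- \<theta>))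
          + (\<Sum>j=2..K. real (class_size f \<kappa> varkappa m j) * ?g (varrho j))"
      by (subst sum_other_classes[OF m]) (rule refl)
    finally show ?thesis
      by (simp add: add_divide_distrib diff_divide_distrib sum_divide_distrib)
  qed
  have "(\<lambda>m. - (\<kappa> m 1 / real m) * (1 - exp (- \<theta>))
        + (\<Sum>j=2..K. (real (class_size f \<kappa> varkappa m j) / real m) * ?g (varrho j))) \<longlonglongrightarrow> \<Lambda>"
    unfolding \<Lambda>_def by (intro tendsto_intros kap fbar)
  then show "(\<lambda>m. ln (\<integral>\<omega>. exp (- \<theta> * X m \<omega>) \<partial>Q m) / real m) \<longlonglongrightarrow> \<Lambda>"
    by (rule Lim_transform_eventually)
       (use eq in \<open>auto intro!: eventually_mono[OF eventually_ge_at_top[of 1]]\<close>)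
  then show "log_laplace Q X \<theta> = \<Lambda>"
    unfolding log_laplace_def by (rule limI)
qed

end

end

(*
  Let W(r) be the coefficient of z^r in exp(c z) * prod_n 1/(1 - rho_n z), where c = kappa_1.  Up to a
  factor it is the partition function with r monomers (and the dissociation constants of m), so that
  P[L_i >= l] = rho_i^l W(m-l)/W(m), E M = c W(m-1)/W(m) and E M(M-1) = c^2 W(m-2)/W(m).
  Everything thus reduces to W(m-1)/W(m) -> x, where x in (0,1) solves g(x) = 1 for
  g(x) = -Lambda'(-ln x).  The coefficients are log-concave, i.e. W(r-1)/W(r) increases with r, and the
  logarithmic derivative of the generating function gives
    r W(r) = c W(r-1) + sum_n sum_{k>=1} rho_n^k W(r-k).
  If W(r-1)/W(r) <= y then W(r-k) <= y^k W(r), and the recurrence at r bounds g(y) from below; if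
  W(r-1)/W(r) >= y then W(r+N-k) >= y^k W(r+N) for k <= N, and the recurrence at r+N bounds g(y) from
  above.  After division by m these bounds leave only y = x.
*)
theory Submission
  imports Defs "HOL-Computational_Algebra.Formal_Power_Series"
begin

section \<open>Generating function of the partition function\<close>

text \<open>The obstacle is that the recurrence couples W(m) to all earlier coefficients, while the
  whole array W changes with m. Monotone ratios turn one hypothetical inequality on a single ratio
  into geometric bounds on the terms of the recurrence; both resulting bounds are used in
  contrapositive form. They are asymmetric because a lower bound on the ratio propagates only to
  larger indices: hence the recurrence is applied N steps later and truncated at k = N, with N fixed
  before m grows. Filaments with rho = 1 are harmless because only y < 1 occurs: each contributes at
  most y/(1 - y), and there are o(m) of them. Supercriticality says g(1) = kappabar + sbar > 1,
  which puts the root strictly inside (0,1). Finally ell'(1) = ln x, since t = -ln x maximizes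
  -theta - Lambda(theta), and a supremum is differentiated by differentiating the expression at its
  maximizer.\<close>

definition geo_fps :: "real \<Rightarrow> real fps" where
  "geo_fps r = Abs_fps (\<lambda>k. r ^ k)"

definition gen_fun :: "real \<Rightarrow> ('i \<Rightarrow> real) \<Rightarrow> 'i set \<Rightarrow> real fps" where
  "gen_fun c \<rho> I = fps_exp c * (\<Prod>n\<in>I. geo_fps (\<rho> n))"

text \<open>Extensional functions make this set finite for finite \<open>I\<close> and let it match
  the index set of \<open>normalization\<close>.\<close>

definition configs :: "'i set \<Rightarrow> nat \<Rightarrow> ('i \<Rightarrow> nat) set" where
  "configs I r = {l \<in> I \<rightarrow>\<^sub>E (UNIV :: nat set). (\<Sum>n\<in>I. l n) \<le> r}"

text \<open>For c = kappa_1 and rho_n = c / kappa_n this is the stationary weight times c^r / r!.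
  The common factor cancels in probabilities, and sums over configurations become power series
  coefficients.\<close>

definition config_weight :: "real \<Rightarrow> ('i \<Rightarrow> real) \<Rightarrow> 'i set \<Rightarrow> nat \<Rightarrow> ('i \<Rightarrow> nat) \<Rightarrow> real" where
  "config_weight c \<rho> I r l =
     (\<Prod>n\<in>I. \<rho> n ^ l n) * c ^ (r - (\<Sum>n\<in>I. l n)) / fact (r - (\<Sum>n\<in>I. l n))"

lemma geo_fps_nth [simp]: "fps_nth (geo_fps r) k = r ^ k"
  by (simp add: geo_fps_def)

lemma gen_fun_empty [simp]: "gen_fun c \<rho> {} = fps_exp c"
  by (simp add: gen_fun_def)

lemma gen_fun_insert:
  assumes "finite I" "i \<notin> I"
  shows "gen_fun c \<rho> (insert i I) = geo_fps (\<rho> i) * gen_fun c \<rho> I"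
  using assms by (simp add: gen_fun_def mult_ac)

lemma finite_configs:
  assumes "finite I"
  shows "finite (configs I r)"
proof (rule finite_subset)
  show "configs I r \<subseteq> I \<rightarrow>\<^sub>E {..r}"
  proof
    fix l assume l: "l \<in> configs I r"
    have "l n \<le> r" if "n \<in> I" for n
      using member_le_sum[of n I l] that assms l by (auto simp: configs_def)
    then show "l \<in> I \<rightarrow>\<^sub>E {..r}"
      using l by (auto simp: configs_def PiE_iff)
  qed
qed (simp add: assms finite_PiE)

lemma configs_insert:
  assumes "finite I" "i \<notin> I"
  shows "bij_betw (\<lambda>(k, l). l(i := k)) (SIGMA k:{..r}. configs I (r - k)) (configs (insert i I) r)"
\<comment> \<open>The inverse resets coordinate \<open>i\<close> to \<open>undefined\<close> because
  elements of \<open>configs I\<close> are extensional on \<open>I\<close>.\<close>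
proof (rule bij_betw_byWitness[where f' = "\<lambda>l. (l i, l(i := undefined))"])
  have [simp]: "sum (l(i := k)) I = sum l I"
      "(\<Sum>n\<in>I. if n = i then k else l n) = sum l I" for l :: "'a \<Rightarrow> nat" and k
    using assms by (auto intro!: sum.cong)
  show "\<forall>a\<in>SIGMA k:{..r}. configs I (r - k).
      (\<lambda>l. (l i, l(i := undefined))) ((\<lambda>(k, l). l(i := k)) a) = a"
    using assms by (auto simp: configs_def PiE_def extensional_def)
  show "\<forall>l\<in>configs (insert i I) r. (\<lambda>(k, l). l(i := k)) (l i, l(i := undefined)) = l"
    by auto
  show "(\<lambda>(k, l). l(i := k)) ` (SIGMA k:{..r}. configs I (r - k)) \<subseteq> configs (insert i I) r"
  proof (intro image_subsetI)
    fix p assume "p \<in> (SIGMA k:{..r}. configs I (r - k))"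
    then obtain k l where p: "p = (k, l)" "k \<le> r" and l: "l \<in> configs I (r - k)" by auto
    then have "sum (l(i := k)) (insert i I) \<le> r"
      using assms by (auto simp: configs_def)
    then show "(\<lambda>(k, l). l(i := k)) p \<in> configs (insert i I) r"
      using l by (auto simp: p configs_def PiE_def extensional_def)
  qed
  show "(\<lambda>l. (l i, l(i := undefined))) ` configs (insert i I) r \<subseteq> (SIGMA k:{..r}. configs I (r - k))"
    using assms by (auto simp: configs_def PiE_def extensional_def)
qed

text \<open>Multiplying by a geometric series sums over the length k of the added filament, leaving
  r - k monomers for the others.\<close>

lemma gen_fun_nth:
  assumes "finite I"
  shows "fps_nth (gen_fun c \<rho> I) r = (\<Sum>l\<in>configs I r. config_weight c \<rho> I r l)"
  using assms
proof (induction I arbitrary: r rule: finite_induct)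
  case empty
  show ?case by (simp add: configs_def config_weight_def)
next
  case (insert i I)
  have [simp]: "sum (l(i := k)) I = sum l I" "(\<Prod>n\<in>I. \<rho> n ^ (l(i := k)) n) = (\<Prod>n\<in>I. \<rho> n ^ l n)"
      "(\<Prod>n\<in>I. \<rho> n ^ (if n = i then k else l n)) = (\<Prod>n\<in>I. \<rho> n ^ l n)"
      "(\<Sum>n\<in>I. if n = i then k else l n) = sum l I"
    for l :: "'a \<Rightarrow> nat" and k
    using insert.hyps by (auto intro!: sum.cong prod.cong)
  have "fps_nth (gen_fun c \<rho> (insert i I)) r
      = (\<Sum>k\<le>r. \<Sum>l\<in>configs I (r - k). \<rho> i ^ k * config_weight c \<rho> I (r - k) l)"
    using insert by (simp add: gen_fun_insert fps_mult_nth sum_distrib_left atLeast0AtMost)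
  also have "\<dots> = (\<Sum>(k, l)\<in>(SIGMA k:{..r}. configs I (r - k)).
                     \<rho> i ^ k * config_weight c \<rho> I (r - k) l)"
    by (rule sum.Sigma) (auto simp: finite_configs insert.hyps)
  also have "\<dots> = (\<Sum>(k, l)\<in>(SIGMA k:{..r}. configs I (r - k)).
                     config_weight c \<rho> (insert i I) r (l(i := k)))"
    using insert.hyps
    by (intro sum.cong refl) (simp add: config_weight_def case_prod_unfold mult_ac)
  also have "\<dots> = (\<Sum>l\<in>configs (insert i I) r. config_weight c \<rho> (insert i I) r l)"
    using sum.reindex_bij_betw[OF configs_insert[OF insert.hyps],
        of "config_weight c \<rho> (insert i I) r" r]
    by (simp add: case_prod_unfold)
  finally show ?case .
qed

section \<open>Log-concavity and the ratio of consecutive coefficients\<close>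

text \<open>Positivity is included so that the inequality is equivalent to monotonicity of the ratio
  V r / V (Suc r).\<close>

definition log_concave :: "(nat \<Rightarrow> real) \<Rightarrow> bool" where
  "log_concave V \<longleftrightarrow> (\<forall>r. V r > 0 \<and> V r * V (r + 2) \<le> V (r + 1) ^ 2)"

text \<open>After cancelling powers of c the inequality reads (r+1)!^2 <= r! (r+2)!, that is, r+1 <=
  r+2.\<close>

lemma log_concave_exp:
  fixes c :: real
  assumes "c > 0"
  shows "log_concave (fps_nth (fps_exp c))"
proof -
  have "c ^ r / fact r * (c ^ (r + 2) / fact (r + 2)) \<le> (c ^ (r + 1) / fact (r + 1)) ^ 2" for r
  proof -
    have "(fact (r + 1) :: real) ^ 2 = (real r + 1) * (real r + 1) * fact r * fact r"
      by (simp add: power2_eq_square algebra_simps)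
    also have "\<dots> \<le> (real r + 2) * (real r + 1) * fact r * fact r"
      by (intro mult_right_mono) auto
    also have "\<dots> = fact r * fact (r + 2)"
      by (simp add: algebra_simps)
    finally have "c ^ (2 * r + 2) / (fact r * fact (r + 2)) \<le> c ^ (2 * r + 2) / (fact (r + 1)) ^ 2"
      using assms by (intro divide_left_mono) auto
    moreover have "c ^ (2 * r + 2) = c ^ r * c ^ (r + 2)" "c ^ (2 * r + 2) = (c ^ (r + 1)) ^ 2"
      by (simp_all add: power2_eq_square mult_2 power_add)
    ultimately show ?thesis
      unfolding power_divide times_divide_times_eq by (simp only:)
  qed
  then show ?thesis
    using assms by (simp add: log_concave_def del: fact_Suc)
qed

text \<open>The product has coefficients u(r+1) = v(r+1) + rho u(r). In u(r+1)^2 - u(r) u(r+2) the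
  terms rho u(r) u(r+1) cancel, leaving u(r+1) v(r+1) - u(r) v(r+2), which \<open>step\<close> shows
  to be nonnegative.\<close>

lemma log_concave_geo:
  assumes "log_concave (fps_nth V)" "\<rho> \<ge> 0"
  shows "log_concave (fps_nth (geo_fps \<rho> * V))"
proof -
  define v where "v = fps_nth V"
  define u where "u = fps_nth (geo_fps \<rho> * V)"
  have "geo_fps \<rho> = 1 + fps_const \<rho> * fps_X * geo_fps \<rho>"
  proof (rule fps_ext)
    fix k show "fps_nth (geo_fps \<rho>) k = fps_nth (1 + fps_const \<rho> * fps_X * geo_fps \<rho>) k"
      by (cases k) (simp_all add: mult.assoc)
  qed
  then have "geo_fps \<rho> * V = (1 + fps_const \<rho> * fps_X * geo_fps \<rho>) * V"
    by (rule arg_cong)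
  also have "\<dots> = V + fps_const \<rho> * fps_X * (geo_fps \<rho> * V)"
    by (simp only: distrib_right mult.assoc mult_1)
  finally have "u r = fps_nth (V + fps_const \<rho> * fps_X * (geo_fps \<rho> * V)) r" for r
    unfolding u_def by (rule arg_cong)
  then have u: "u r = v r + \<rho> * (if r = 0 then 0 else u (r - 1))" for r
    by (simp add: u_def v_def mult.assoc)
  have v: "v r > 0" "v r * v (r + 2) \<le> v (r + 1) ^ 2" for r
    using assms(1) by (auto simp: log_concave_def v_def)
  have u0: "u 0 = v 0" and us: "u (Suc r) = v (Suc r) + \<rho> * u r" for r
    by (auto simp: u[of 0] u[of "Suc r"])
  have upos: "u r > 0" for r
    by (induction r) (use v assms(2) in \<open>auto simp: u0 us intro!: add_pos_nonneg\<close>)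
  have step: "u r * v (r + 2) \<le> u (r + 1) * v (r + 1)" for r
  proof (induction r)
    case 0
    have "v 0 * v 2 \<le> v 1 * v 1" using v(2)[of 0] by (simp add: power2_eq_square eval_nat_numeral)
    also have "\<dots> \<le> u 1 * v 1"
      using v(1) assms(2) by (intro mult_right_mono) (auto simp: u0 us less_imp_le)
    finally show ?case by (simp add: u0 eval_nat_numeral)
  next
    case (Suc r)
    \<comment> \<open>The induction hypothesis bounds this ratio by v(r+1)/v(r+2), and log-concavity
      of v advances the bound by one index. The recursion for u then adds v(r+1) v(r+3) <=
      v(r+2)^2.\<close>
    have "u r / u (r + 1) \<le> v (r + 1) / v (r + 2)"
      using Suc v(1) upos by (simp add: field_simps)
    also have "\<dots> \<le> v (r + 2) / v (r + 3)"
      using v(2)[of "r + 1"] v(1) by (simp add: field_simps power2_eq_square eval_nat_numeral)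
    finally have "\<rho> * (u r * v (r + 3)) \<le> \<rho> * (u (r + 1) * v (r + 2))"
      using v(1) upos assms(2) by (intro mult_left_mono) (simp_all add: field_simps)
    with v(2)[of "r + 1"] show ?case
      by (simp add: us algebra_simps power2_eq_square eval_nat_numeral)
  qed
  have "u r * u (r + 2) \<le> u (r + 1) ^ 2" for r
    using step[of r] us[of "Suc r"] us[of r] by (simp add: algebra_simps power2_eq_square)
  with upos show ?thesis by (simp add: log_concave_def u_def)
qed

lemma log_concave_gen_fun:
  assumes "finite I" "c > 0" "\<And>n. n \<in> I \<Longrightarrow> \<rho> n \<ge> 0"
  shows "log_concave (fps_nth (gen_fun c \<rho> I))"
  using assms
  by (induction I rule: finite_induct) (auto simp: log_concave_exp gen_fun_insert log_concave_geo)

lemma log_concave_ratio_mono: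
  assumes "log_concave V" "r \<le> s"
  shows "V r / V (Suc r) \<le> V s / V (Suc s)"
  using assms(2)
proof (rule lift_Suc_mono_le[rotated])
  fix r
  show "V r / V (Suc r) \<le> V (Suc r) / V (Suc (Suc r))"
    using assms(1)[unfolded log_concave_def, rule_format, of r]
      assms(1)[unfolded log_concave_def, rule_format, of "Suc r"]
      assms(1)[unfolded log_concave_def, rule_format, of "Suc (Suc r)"]
    by (simp add: field_simps power2_eq_square)
qed

text \<open>By monotonicity every ratio at an index below r is at most x too, so each step down
  costs a factor of at most x.\<close>

lemma log_concave_power_upper:
  assumes V: "log_concave V" and x: "V r / V (Suc r) \<le> x" and k: "k \<le> Suc r"
  shows "V (Suc r - k) \<le> x ^ k * V (Suc r)"
  using k
proof (induction k)
  case (Suc k)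
  have pos: "V s > 0" for s using V by (simp add: log_concave_def)
  have "x \<ge> 0" using x pos by (smt (verit) divide_pos_pos)
  have "V (r - k) / V (Suc (r - k)) \<le> x"
    using log_concave_ratio_mono[OF V, of "r - k" r] x by linarith
  then have "V (r - k) \<le> x * V (Suc r - k)"
    using pos Suc.prems by (simp add: field_simps Suc_diff_le)
  also have "\<dots> \<le> x * (x ^ k * V (Suc r))"
    using \<open>x \<ge> 0\<close> Suc by (intro mult_left_mono) auto
  finally show ?case by (simp add: mult_ac)
qed simp

text \<open>Here only ratios at indices from r on are controlled; the k steps down start at r + j +
  k and must not pass below r.\<close>

lemma log_concave_power_lower:
  assumes V: "log_concave V" and x: "0 \<le> x" "x \<le> V r / V (Suc r)"
  shows "x ^ k * V (r + j + k) \<le> V (r + j)"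
proof (induction k)
  case (Suc k)
  have pos: "V s > 0" for s using V by (simp add: log_concave_def)
  have "x \<le> V (r + j + k) / V (Suc (r + j + k))"
    using log_concave_ratio_mono[OF V, of r "r + j + k"] x by linarith
  then have "x * V (r + j + Suc k) \<le> V (r + j + k)"
    using pos by (simp add: field_simps)
  then have "x ^ k * (x * V (r + j + Suc k)) \<le> x ^ k * V (r + j + k)"
    using x by (intro mult_left_mono) auto
  with Suc show ?case by (simp add: mult_ac)
qed simp

section \<open>Recurrence for the coefficients and its one-sided bounds\<close>

lemma gen_fun_recurrence:
  fixes c :: real and \<rho> :: "'i \<Rightarrow> real"
  assumes "finite I" "r > 0"
  defines "W \<equiv> fps_nth (gen_fun c \<rho> I)"
  shows "real r * W r = c * W (r - 1) + (\<Sum>n\<in>I. \<Sum>k=1..r. \<rho> n ^ k * W (r - k))"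
proof -
  \<comment> \<open>For A = 1/(1 - a z) one has z A' = a z / (1 - a z)^2 = A (A - 1).\<close>
  have geo: "fps_X * fps_deriv (geo_fps a) = geo_fps a * (geo_fps a - 1)" for a
  proof (rule fps_ext)
    fix k
    have "fps_nth (geo_fps a * geo_fps a) k = (real k + 1) * a ^ k"
      by (simp add: fps_mult_nth flip: power_add)
    then show "fps_nth (fps_X * fps_deriv (geo_fps a)) k = fps_nth (geo_fps a * (geo_fps a - 1)) k"
      by (cases k) (simp_all add: right_diff_distrib algebra_simps)
  qed
  \<comment> \<open>The logarithmic derivative is a sum over the factors; it is kept free of
    division so that the product rule can add one filament at a time.\<close>
  have "fps_X * fps_deriv (gen_fun c \<rho> I)
      = gen_fun c \<rho> I * (fps_const c * fps_X + (\<Sum>n\<in>I. geo_fps (\<rho> n) - 1))"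
    using assms(1)
  proof (induction I rule: finite_induct)
    case (insert i I)
    have "fps_X * fps_deriv (gen_fun c \<rho> (insert i I))
        = fps_X * fps_deriv (geo_fps (\<rho> i)) * gen_fun c \<rho> I
          + geo_fps (\<rho> i) * (fps_X * fps_deriv (gen_fun c \<rho> I))"
      using insert.hyps by (simp add: gen_fun_insert algebra_simps)
    then show ?case
      using insert by (simp add: geo gen_fun_insert algebra_simps)
  qed (simp add: mult_ac)
  then have "fps_nth (fps_X * fps_deriv (gen_fun c \<rho> I)) r
      = c * W (r - 1) + (\<Sum>n\<in>I. fps_nth ((geo_fps (\<rho> n) - 1) * gen_fun c \<rho> I) r)"
    using assms(2)
    by (simp add: distrib_left sum_distrib_left fps_sum_nth W_def mult.commute[of _ "gen_fun c \<rho> I"]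
        mult.left_commute[of _ "fps_const c"])
  \<comment> \<open>Subtracting 1 deletes the k = 0 term of the convolution, so \<open>W r\<close>
    itself is absent from the right side.\<close>
  moreover have "fps_nth ((geo_fps (\<rho> n) - 1) * gen_fun c \<rho> I) r = (\<Sum>k=1..r. \<rho> n ^ k * W (r - k))" for n
    unfolding fps_mult_nth W_def
    by (subst sum.atLeast_Suc_atMost) (auto intro!: sum.cong)
  ultimately show ?thesis
    using assms(2) by (simp add: W_def)
qed

text \<open>After division by \<open>W (Suc r)\<close> the k-th term of filament n is at most (rho_n
  x)^k, and the finite geometric sum is at most the full series. Contrapositively, the ratio exceeds
  x once the right side is below \<open>Suc r\<close>.\<close>

lemma gen_fun_ratio_le:
  fixes c :: real and \<rho> :: "'i \<Rightarrow> real"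
  assumes fin: "finite I" and c: "c > 0" and \<rho>: "\<And>n. n \<in> I \<Longrightarrow> 0 \<le> \<rho> n \<and> \<rho> n * x < 1"
  defines "W \<equiv> fps_nth (gen_fun c \<rho> I)"
  assumes x: "W r / W (Suc r) \<le> x"
  shows "real (Suc r) \<le> c * x + (\<Sum>n\<in>I. \<rho> n * x / (1 - \<rho> n * x))"
proof -
  have lc: "log_concave W" unfolding W_def using fin c \<rho> by (intro log_concave_gen_fun) auto
  then have pos: "W s > 0" for s by (simp add: log_concave_def)
  have x0: "x \<ge> 0" using x pos by (smt (verit) divide_pos_pos)
  have "real (Suc r) * W (Suc r) = c * W (Suc r - 1) + (\<Sum>n\<in>I. \<Sum>k=1..Suc r. \<rho> n ^ k * W (Suc r - k))"
    unfolding W_def using fin by (intro gen_fun_recurrence) auto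
  also have "\<dots> \<le> c * (x ^ 1 * W (Suc r)) + (\<Sum>n\<in>I. \<rho> n * x / (1 - \<rho> n * x) * W (Suc r))"
  proof (intro add_mono mult_left_mono sum_mono)
    show "W (Suc r - 1) \<le> x ^ 1 * W (Suc r)"
      by (rule log_concave_power_upper[OF lc x]) simp
    fix n assume n: "n \<in> I"
    let ?a = "\<rho> n * x"
    have a: "0 \<le> ?a" "?a < 1" using \<rho>[OF n] x0 by auto
    have "(\<Sum>k=1..Suc r. \<rho> n ^ k * W (Suc r - k)) \<le> (\<Sum>k=1..Suc r. \<rho> n ^ k * (x ^ k * W (Suc r)))"
      using \<rho>[OF n] log_concave_power_upper[OF lc x] by (intro sum_mono mult_left_mono) auto
    also have "\<dots> = (\<Sum>k=1..Suc r. ?a ^ k) * W (Suc r)"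
      unfolding sum_distrib_right power_mult_distrib mult.assoc ..
    also have "(\<Sum>k=1..Suc r. ?a ^ k) = ?a * (\<Sum>k<Suc r. ?a ^ k)"
      unfolding sum_distrib_left by (simp add: sum.atLeast1_atMost_eq)
    also have "(\<Sum>k<Suc r. ?a ^ k) = (1 - ?a ^ Suc r) / (1 - ?a)"
      using a sum_gp_strict[of ?a "Suc r"] by simp
    also have "?a * ((1 - ?a ^ Suc r) / (1 - ?a)) * W (Suc r) \<le> ?a / (1 - ?a) * W (Suc r)"
    proof (intro mult_right_mono)
      have "?a * (1 - ?a ^ Suc r) \<le> ?a * 1" using a by (intro mult_left_mono) auto
      then show "?a * ((1 - ?a ^ Suc r) / (1 - ?a)) \<le> ?a / (1 - ?a)"
        using a by (simp add: divide_right_mono)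
    qed (simp add: pos less_imp_le)
    finally show "(\<Sum>k=1..Suc r. \<rho> n ^ k * W (Suc r - k)) \<le> ?a / (1 - ?a) * W (Suc r)" .
  qed (use c in auto)
  also have "\<dots> = (c * x + (\<Sum>n\<in>I. \<rho> n * x / (1 - \<rho> n * x))) * W (Suc r)"
    by (simp add: distrib_right sum_distrib_right)
  finally show ?thesis using pos[of "Suc r"] by simp
qed

text \<open>The power bound reaches down to index r only, so the recurrence is used at r + N, from
  where k <= N steps stay in range. The terms with k > N are nonnegative and are dropped.\<close>

lemma gen_fun_ratio_ge:
  fixes c :: real and \<rho> :: "'i \<Rightarrow> real"
  assumes fin: "finite I" and c: "c > 0" and \<rho>: "\<And>n. n \<in> I \<Longrightarrow> 0 \<le> \<rho> n" and N: "N \<ge> 1"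
  defines "W \<equiv> fps_nth (gen_fun c \<rho> I)"
  assumes x: "0 \<le> x" "x \<le> W r / W (Suc r)"
  shows "c * x + (\<Sum>n\<in>I. \<Sum>k=1..N. (\<rho> n * x) ^ k) \<le> real (r + N)"
proof -
  have lc: "log_concave W" unfolding W_def using fin c \<rho> by (intro log_concave_gen_fun) auto
  then have pos: "W s > 0" for s by (simp add: log_concave_def)
  have low: "x ^ k * W (r + N) \<le> W (r + N - k)" if "k \<le> N" for k
    using log_concave_power_lower[OF lc x, of k "N - k"] that by simp
  have "(c * x + (\<Sum>n\<in>I. \<Sum>k=1..N. (\<rho> n * x) ^ k)) * W (r + N)
      = c * (x ^ 1 * W (r + N)) + (\<Sum>n\<in>I. \<Sum>k=1..N. \<rho> n ^ k * (x ^ k * W (r + N)))"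
    unfolding distrib_right sum_distrib_right power_mult_distrib
    by (intro arg_cong2[where f = "(+)"] sum.cong refl) simp_all
  also have "\<dots> \<le> c * W (r + N - 1) + (\<Sum>n\<in>I. \<Sum>k=1..r+N. \<rho> n ^ k * W (r + N - k))"
  proof (intro add_mono mult_left_mono sum_mono low N)
    fix n assume n: "n \<in> I"
    have "(\<Sum>k=1..N. \<rho> n ^ k * (x ^ k * W (r + N))) \<le> (\<Sum>k=1..N. \<rho> n ^ k * W (r + N - k))"
      using \<rho>[OF n] by (intro sum_mono mult_left_mono low) auto
    also have "\<dots> \<le> (\<Sum>k=1..r+N. \<rho> n ^ k * W (r + N - k))"
      using \<rho>[OF n] pos by (intro sum_mono2) (auto simp: less_imp_le)
    finally show "(\<Sum>k=1..N. \<rho> n ^ k * (x ^ k * W (r + N))) \<le> \<dots>" .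
  qed (use c in auto)
  also have "\<dots> = real (r + N) * W (r + N)"
    unfolding W_def using fin N by (intro gen_fun_recurrence[symmetric]) auto
  finally show ?thesis using pos[of "r + N"] by simp
qed

section \<open>Exact formulas for the stationary distribution\<close>

abbreviation free_count :: "'i set \<Rightarrow> nat \<Rightarrow> ('i \<Rightarrow> nat) \<Rightarrow> nat" where
  "free_count I r l \<equiv> r - (\<Sum>n\<in>I. l n)"

text \<open>Shortening filament i by d is a bijection onto the configurations of r - d monomers. It
  keeps the number of free monomers and releases the factor rho_i^d.\<close>

lemma gen_fun_tail:
  assumes I: "finite I" "i \<in> I" and d: "d \<le> r"
  shows "(\<Sum>l | l \<in> configs I r \<and> d \<le> l i. config_weight c \<rho> I r l)
       = \<rho> i ^ d * fps_nth (gen_fun c \<rho> I) (r - d)"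
proof -
  have s: "(\<Sum>n\<in>I. g n) = g i + (\<Sum>n\<in>I-{i}. g n)" for g :: "'a \<Rightarrow> nat"
    using I by (rule sum.remove)
  have p: "(\<Prod>n\<in>I. g n) = g i * (\<Prod>n\<in>I-{i}. g n)" for g :: "'a \<Rightarrow> real"
    using I by (rule prod.remove)
  have "(\<Sum>l | l \<in> configs I r \<and> d \<le> l i. config_weight c \<rho> I r l)
      = (\<Sum>l\<in>configs I (r - d). \<rho> i ^ d * config_weight c \<rho> I (r - d) l)"
  proof (rule sum.reindex_bij_witness[where i = "\<lambda>l. l(i := l i + d)" and j = "\<lambda>l. l(i := l i - d)"])
    fix l assume l: "l \<in> configs I (r - d)"
    then show "l(i := l i + d) \<in> {l \<in> configs I r. d \<le> l i}"
      using I d by (auto simp: configs_def PiE_def extensional_def s)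
  next
    fix l assume l: "l \<in> {l \<in> configs I r. d \<le> l i}"
    then show "l(i := l i - d) \<in> configs I (r - d)"
      using I d by (auto simp: configs_def PiE_def extensional_def s)
    have "l i = d + (l i - d)" using l by simp
    then have "\<rho> i ^ l i = \<rho> i ^ d * \<rho> i ^ (l i - d)" by (metis power_add)
    then show "\<rho> i ^ d * config_weight c \<rho> I (r - d) (l(i := l i - d)) = config_weight c \<rho> I r l"
      using l by (simp add: config_weight_def s p mult_ac)
  qed auto
  then show ?thesis
    using I by (simp add: gen_fun_nth sum_distrib_left)
qed

text \<open>With s free monomers, s c^s / s! = c c^(s-1) / (s-1)!, so weighting by s removes one
  free monomer. The function \<open>F\<close> makes the identity iterable for higher
  moments.\<close>

lemma config_weight_free_count:
  fixes F :: "nat \<Rightarrow> real"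
  assumes I: "finite I"
  shows "(\<Sum>l\<in>configs I (Suc r). real (free_count I (Suc r) l) * F (free_count I (Suc r) l - 1)
            * config_weight c \<rho> I (Suc r) l)
       = c * (\<Sum>l\<in>configs I r. F (free_count I r l) * config_weight c \<rho> I r l)"
proof -
  let ?g = "\<lambda>l. real (free_count I (Suc r) l) * F (free_count I (Suc r) l - 1)
            * config_weight c \<rho> I (Suc r) l"
  \<comment> \<open>Configurations without a free monomer contribute zero, which also makes the
    truncated subtraction inside \<open>F\<close> harmless.\<close>
  have "(\<Sum>l\<in>configs I (Suc r). ?g l) = (\<Sum>l\<in>configs I r. ?g l)"
  proof (rule sum.mono_neutral_right[OF finite_configs[OF I]])
    show "\<forall>l\<in>configs I (Suc r) - configs I r. ?g l = 0"
    proof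
      fix l assume "l \<in> configs I (Suc r) - configs I r"
      then have "free_count I (Suc r) l = 0" by (auto simp: configs_def)
      then show "?g l = 0" by (simp only: of_nat_0 mult_zero_left)
    qed
  qed (auto simp: configs_def)
  also have "\<dots> = (\<Sum>l\<in>configs I r. c * (F (free_count I r l) * config_weight c \<rho> I r l))"
  proof (rule sum.cong[OF refl])
    fix l assume "l \<in> configs I r"
    then have "free_count I (Suc r) l = Suc (free_count I r l)" by (simp add: configs_def Suc_diff_le)
    then show "?g l = c * (F (free_count I r l) * config_weight c \<rho> I r l)"
      by (simp add: config_weight_def divide_simps del: of_nat_Suc)
  qed
  finally show ?thesis by (simp add: sum_distrib_left)
qed

lemma config_weight_first_moment:
  assumes "finite I"
  shows "(\<Sum>l\<in>configs I (Suc r). real (free_count I (Suc r) l) * config_weight c \<rho> I (Suc r) l)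
       = c * fps_nth (gen_fun c \<rho> I) r"
  using config_weight_free_count[OF assms, of r "\<lambda>_. 1" c \<rho>] by (simp add: gen_fun_nth assms)

lemma config_weight_second_moment:
  fixes c :: real and \<rho> :: "'i \<Rightarrow> real"
  assumes "finite I"
  defines "W \<equiv> fps_nth (gen_fun c \<rho> I)"
  assumes r: "r = Suc (Suc q)"
  shows "(\<Sum>l\<in>configs I r. real (free_count I r l) ^ 2 * config_weight c \<rho> I r l)
       = c * W (Suc q) + c ^ 2 * W q"
proof -
  have "(\<Sum>l\<in>configs I r. real (free_count I r l) ^ 2 * config_weight c \<rho> I r l)
      = (\<Sum>l\<in>configs I (Suc (Suc q)). real (free_count I (Suc (Suc q)) l)
           * (real (free_count I (Suc (Suc q)) l - 1) + 1) * config_weight c \<rho> I (Suc (Suc q)) l)"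
  proof (unfold r, rule sum.cong[OF refl])
    fix l
    \<comment> \<open>This puts the square into the form of \<open>config_weight_free_count\<close>
      with F s = s + 1.\<close>
    have "real s ^ 2 = real s * (real (s - 1) + 1)" for s
      by (cases s) (auto simp: power2_eq_square)
    then show "real (free_count I (Suc (Suc q)) l) ^ 2 * config_weight c \<rho> I (Suc (Suc q)) l
      = real (free_count I (Suc (Suc q)) l)
           * (real (free_count I (Suc (Suc q)) l - 1) + 1) * config_weight c \<rho> I (Suc (Suc q)) l"
      by simp
  qed
  also have "\<dots> = c * (\<Sum>l\<in>configs I (Suc q). (real (free_count I (Suc q) l) + 1) * config_weight c \<rho> I (Suc q) l)"
    by (rule config_weight_free_count[OF assms(1)])
  also have "\<dots> = c * W (Suc q) + c ^ 2 * W q"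
    using config_weight_first_moment[OF assms(1), of q c \<rho>]
    by (simp add: W_def gen_fun_nth[OF assms(1), of c \<rho> "Suc q"] distrib_right distrib_left sum.distrib power2_eq_square)
  finally show ?thesis .
qed

section \<open>Transfer of the coefficient identities to the random lengths\<close>

context stationary_lengths
begin

context
  fixes W :: "nat \<Rightarrow> real" and w :: "(nat \<Rightarrow> nat) \<Rightarrow> real" and \<rho> :: "nat \<Rightarrow> real"
  assumes kpos: "\<And>n. n \<in> {1..fm} \<Longrightarrow> k n > 0" and fm: "fm \<ge> 1"
  defines "\<rho> \<equiv> \<lambda>n. k 1 / k n"
    and "W \<equiv> fps_nth (gen_fun (k 1) (\<lambda>n. k 1 / k n) {1..fm})"
    and "w \<equiv> config_weight (k 1) (\<lambda>n. k 1 / k n) {1..fm} m"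
begin

lemma k1_pos: "k 1 > 0"
  using kpos fm by auto

lemma W_pos: "W r > 0"
proof -
  have "log_concave W"
    unfolding W_def using kpos k1_pos by (intro log_concave_gen_fun) (auto simp: less_imp_le)
  then show ?thesis by (simp add: log_concave_def)
qed

lemma w_nonneg: "w l \<ge> 0"
  unfolding w_def config_weight_def using kpos k1_pos
  by (auto intro!: mult_nonneg_nonneg divide_nonneg_nonneg prod_nonneg zero_le_power simp: less_imp_le)

lemma sum_w: "(\<Sum>l\<in>configs {1..fm} m. w l) = W m"
  by (simp add: W_def w_def gen_fun_nth)

lemma config_prob:
  assumes l: "l \<in> configs {1..fm} m"
  shows "prob {\<omega> \<in> space P. \<forall>n\<in>{1..fm}. L n \<omega> = l n} = w l / W m"
proof -
  have weight: "weight m fm k l = fact m / k 1 ^ m * w l" if "l \<in> configs {1..fm} m" for l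
  proof -
    have "(\<Sum>n=1..fm. l n) \<le> m" using that by (simp add: configs_def)
    then have "k 1 ^ m = k 1 ^ (\<Sum>n=1..fm. l n) * k 1 ^ free_count {1..fm} m l"
      by (simp flip: power_add)
    moreover have "(\<Prod>n=1..fm. (k 1 / k n) ^ l n)
        = k 1 ^ (\<Sum>n=1..fm. l n) * (\<Prod>n=1..fm. inverse (k n) ^ l n)"
      by (simp add: divide_inverse power_mult_distrib prod.distrib power_sum)
    ultimately show ?thesis
      using k1_pos by (simp add: weight_def w_def config_weight_def)
  qed
  have "normalization m fm k = (\<Sum>l\<in>configs {1..fm} m. weight m fm k l)"
    by (simp add: normalization_def configs_def)
  also have "\<dots> = fact m / k 1 ^ m * W m"
    unfolding sum_w[symmetric] sum_distrib_left by (intro sum.cong refl weight)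
  finally have norm: "normalization m fm k = fact m / k 1 ^ m * W m" .
  have "prob {\<omega> \<in> space P. \<forall>n\<in>{1..fm}. L n \<omega> = l n} = weight m fm k l / normalization m fm k"
    using l by (intro law) (simp add: configs_def)
  also have "\<dots> = w l / W m"
    using k1_pos by (simp add: weight[OF l] norm)
  finally show ?thesis .
qed

text \<open>The law is prescribed only on \<open>configs\<close>, but those probabilities already
  sum to 1. All other outcomes are therefore null, and an event reduces to a finite sum. Restricting
  the lengths to \<open>{1..fm}\<close> matches the extensionality of configurations.\<close>

lemma prob_eq_config_sum:
  assumes B: "{\<omega> \<in> space P. \<Phi> (\<lambda>n\<in>{1..fm}. L n \<omega>)} \<in> events"
  shows "prob {\<omega> \<in> space P. \<Phi> (\<lambda>n\<in>{1..fm}. L n \<omega>)}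
       = (\<Sum>l | l \<in> configs {1..fm} m \<and> \<Phi> l. w l / W m)"
proof -
  let ?C = "configs {1..fm} m"
  define A where "A l = {\<omega> \<in> space P. \<forall>n\<in>{1..fm}. L n \<omega> = l n}" for l
  have A: "A l \<in> events" for l
  proof -
    note rv [measurable]
    have "{\<omega> \<in> space P. L n \<omega> = l n} \<in> events" if "n \<in> {1..fm}" for n
      using that by measurable
    then show ?thesis unfolding A_def by (intro sets.sets_Collect_finite_All) auto
  qed
  have inA: "\<omega> \<in> A l \<longleftrightarrow> \<omega> \<in> space P \<and> (\<lambda>n\<in>{1..fm}. L n \<omega>) = l" if "l \<in> ?C" for l \<omega>
    using that unfolding A_def configs_def PiE_def extensional_def by (auto simp: fun_eq_iff)
  have fin: "finite ?C" by (simp add: finite_configs)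
  have sum: "prob (\<Union>l\<in>D. A l) = (\<Sum>l\<in>D. w l / W m)" if D: "D \<subseteq> ?C" for D
  proof -
    have "disjoint_family_on A D"
      using D unfolding disjoint_family_on_def disjoint_iff by (metis inA subsetD)
    then have "prob (\<Union>l\<in>D. A l) = (\<Sum>l\<in>D. prob (A l))"
      using D fin A by (intro finite_measure_finite_Union) (auto intro: finite_subset)
    also have "\<dots> = (\<Sum>l\<in>D. w l / W m)"
      using D config_prob by (intro sum.cong) (auto simp: A_def)
    finally show ?thesis .
  qed
  have "prob (\<Union>l\<in>?C. A l) = (\<Sum>l\<in>?C. w l) / W m"
    by (simp add: sum sum_divide_distrib)
  also note sum_w
  finally have "prob (\<Union>l\<in>?C. A l) = 1"
    using W_pos[of m] by simp
  moreover have "(\<Union>l\<in>?C. A l) \<in> events"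
    using A fin by auto
  ultimately have "AE \<omega> in P. \<omega> \<in> (\<Union>l\<in>?C. A l)"
    using prob_eq_1 by blast
  then have "prob {\<omega> \<in> space P. \<Phi> (\<lambda>n\<in>{1..fm}. L n \<omega>)} = prob (\<Union>l\<in>{l \<in> ?C. \<Phi> l}. A l)"
  proof (intro finite_measure_eq_AE)
    show "AE \<omega> in P. \<omega> \<in> {\<omega> \<in> space P. \<Phi> (\<lambda>n\<in>{1..fm}. L n \<omega>)}
        \<longleftrightarrow> \<omega> \<in> (\<Union>l\<in>{l \<in> ?C. \<Phi> l}. A l)"
      using \<open>AE \<omega> in P. \<omega> \<in> (\<Union>l\<in>?C. A l)\<close> by eventually_elim (use inA in auto)
  qed (use A B fin in auto)
  also have "\<dots> = (\<Sum>l | l \<in> ?C \<and> \<Phi> l. w l / W m)"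
    by (intro sum) auto
  finally show ?thesis .
qed

lemma length_tail:
  assumes i: "i \<in> {1..fm}" and d: "d \<le> m"
  shows "prob {\<omega> \<in> space P. L i \<omega> \<ge> d} = \<rho> i ^ d * (W (m - d) / W m)"
proof -
  note rv[OF i, measurable]
  have "prob {\<omega> \<in> space P. L i \<omega> \<ge> d} = prob {\<omega> \<in> space P. d \<le> (\<lambda>n\<in>{1..fm}. L n \<omega>) i}"
    using i by simp
  also have "\<dots> = (\<Sum>l | l \<in> configs {1..fm} m \<and> d \<le> l i. w l / W m)"
    using i by (intro prob_eq_config_sum) simp
  also have "\<dots> = \<rho> i ^ d * (W (m - d) / W m)"
    using gen_fun_tail[OF _ i d, of "k 1" \<rho>] by (simp add: W_def w_def \<rho>_def flip: sum_divide_distrib)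
  finally show ?thesis .
qed

text \<open>Chebyshev's inequality around an arbitrary centre y: the numerator is E (M/m - y)^2
  expanded with the exact first two moments. A free y allows centring at the limit instead of at the
  mean.\<close>

lemma monomers_deviation:
  assumes m: "m \<ge> 2" and \<epsilon>: "\<epsilon> > 0"
  defines "u \<equiv> W (m - 1) / W m" and "v \<equiv> W (m - 2) / W m" and "c \<equiv> k 1 / real m"
  shows "prob {\<omega> \<in> space P. \<bar>monomers m fm L \<omega> / real m - y\<bar> > \<epsilon>}
       \<le> (c * u / real m + c ^ 2 * v - 2 * y * (c * u) + y ^ 2) / \<epsilon> ^ 2"
proof -
  let ?C = "configs {1..fm} m"
  let ?s = "free_count {1..fm} m"
  let ?\<Phi> = "\<lambda>l. \<bar>(real m - (\<Sum>n=1..fm. real (l n))) / real m - y\<bar> > \<epsilon>"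
  obtain q where q: "m = Suc (Suc q)" using m by (metis add_2_eq_Suc le_Suc_ex)
  have moments: "(\<Sum>l\<in>?C. real (?s l) ^ 2 * w l) = k 1 * W (m - 1) + k 1 ^ 2 * W (m - 2)"
      "(\<Sum>l\<in>?C. real (?s l) * w l) = k 1 * W (m - 1)"
    using config_weight_second_moment[OF _ q, of "{1..fm}" "k 1" "\<lambda>n. k 1 / k n"]
      config_weight_first_moment[of "{1..fm}" "Suc q" "k 1" "\<lambda>n. k 1 / k n"]
    by (simp_all add: q W_def w_def)
  have eq: "{\<omega> \<in> space P. \<bar>monomers m fm L \<omega> / real m - y\<bar> > \<epsilon>}
      = {\<omega> \<in> space P. ?\<Phi> (\<lambda>n\<in>{1..fm}. L n \<omega>)}"
    by (simp add: monomers_def)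
  have "(\<lambda>\<omega>. monomers m fm L \<omega>) \<in> borel_measurable P"
    unfolding monomers_def
    by (intro borel_measurable_diff borel_measurable_sum borel_measurable_const
        measurable_compose[OF rv]) auto
  then have "{\<omega> \<in> space P. \<bar>monomers m fm L \<omega> / real m - y\<bar> > \<epsilon>} \<in> events"
    by measurable
  then have "prob {\<omega> \<in> space P. \<bar>monomers m fm L \<omega> / real m - y\<bar> > \<epsilon>}
      = (\<Sum>l | l \<in> ?C \<and> ?\<Phi> l. w l / W m)"
    unfolding eq by (rule prob_eq_config_sum)
  also have "\<dots> \<le> (\<Sum>l | l \<in> ?C \<and> ?\<Phi> l. (real (?s l) / m - y) ^ 2 / \<epsilon> ^ 2 * (w l / W m))"
  proof (rule sum_mono)
    fix l assume l: "l \<in> {l \<in> ?C. ?\<Phi> l}"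
    then have "\<bar>real (?s l) / m - y\<bar> > \<epsilon>" by (simp add: configs_def of_nat_diff)
    then have "1 \<le> (real (?s l) / m - y) ^ 2 / \<epsilon> ^ 2"
      using \<epsilon> abs_le_square_iff[of \<epsilon> "real (?s l) / m - y"] by simp
    then show "w l / W m \<le> (real (?s l) / m - y) ^ 2 / \<epsilon> ^ 2 * (w l / W m)"
      using w_nonneg[of l] W_pos[of m] by (metis divide_nonneg_pos mult_1 mult_right_mono)
  qed
  also have "\<dots> \<le> (\<Sum>l\<in>?C. (real (?s l) / m - y) ^ 2 / \<epsilon> ^ 2 * (w l / W m))"
    using w_nonneg W_pos[of m] by (intro sum_mono2) (auto simp: finite_configs intro!: mult_nonneg_nonneg divide_nonneg_pos)
  also have "\<dots> = (\<Sum>l\<in>?C. (real (?s l) ^ 2 * w l) * (1 / m ^ 2) - (real (?s l) * w l) * (2 * y / m)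
                     + w l * y ^ 2) / (W m * \<epsilon> ^ 2)"
    unfolding sum_divide_distrib
    by (intro sum.cong refl) (use m in \<open>simp add: power2_eq_square field_simps\<close>)
  also have "\<dots> = ((k 1 * W (m - 1) + k 1 ^ 2 * W (m - 2)) * (1 / m ^ 2) - k 1 * W (m - 1) * (2 * y / m)
                    + W m * y ^ 2) / (W m * \<epsilon> ^ 2)"
    unfolding sum.distrib sum_subtractf sum_distrib_right[symmetric] moments sum_w ..
  also have "\<dots> = (c * u / real m + c ^ 2 * v - 2 * y * (c * u) + y ^ 2) / \<epsilon> ^ 2"
    using W_pos[of m] m \<epsilon> by (simp add: u_def v_def c_def power2_eq_square field_simps)
  finally show ?thesis .
qed

end

end

section \<open>Auxiliary variables and the rate function\<close>

lemma (in auxiliary_variables) mean_poisson: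
  assumes "k 1 > 0"
  shows "expectation (\<lambda>\<omega>. real (AM \<omega>)) = k 1"
proof -
  have rv: "random_variable (count_space UNIV) AM"
    using indep unfolding indep_vars_def by (auto dest: bspec[of _ _ 0])
  have "(\<lambda>n. k 1 ^ n /\<^sub>R fact n) sums exp (k 1)"
    by (rule exp_converges)
  from sums_mult[OF this, of "exp (- k 1) * k 1"]
  have "(\<lambda>n. real (Suc n) * prob {\<omega> \<in> space Q. AM \<omega> = Suc n}) sums k 1"
    using assms by (simp add: poisson exp_minus field_simps del: of_nat_Suc)
  \<comment> \<open>The term at n = 0 vanishes, so undoing the index shift leaves the sum
    unchanged.\<close>
  from sums_Suc[OF this] have "(\<lambda>n. real n * prob {\<omega> \<in> space Q. AM \<omega> = n}) sums k 1"
    by simp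
  from expectation_nat_sums(2)[OF rv _ this] show ?thesis by simp
qed

lemma (in auxiliary_variables) mean_geometric:
  assumes n: "n \<in> {f1<..fm}" and r: "0 < k 1 / k n" "k 1 / k n < 1"
  shows "integrable Q (\<lambda>\<omega>. real (AL n \<omega>))"
    and "expectation (\<lambda>\<omega>. real (AL n \<omega>)) = (k 1 / k n) / (1 - k 1 / k n)"
proof -
  define \<rho> where "\<rho> = k 1 / k n"
  have rv [measurable]: "random_variable (count_space UNIV) (AL n)"
    using indep n unfolding indep_vars_def by (auto dest: bspec[of _ _ n])
  have point: "prob {\<omega> \<in> space Q. AL n \<omega> = x} = (1 - \<rho>) * \<rho> ^ x" for x
  proof -
    have "{\<omega> \<in> space Q. AL n \<omega> = x} = {\<omega> \<in> space Q. AL n \<omega> \<ge> x} - {\<omega> \<in> space Q. AL n \<omega> \<ge> Suc x}"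
      by auto
    also have "prob \<dots> = prob {\<omega> \<in> space Q. AL n \<omega> \<ge> x} - prob {\<omega> \<in> space Q. AL n \<omega> \<ge> Suc x}"
      by (rule finite_measure_Diff) auto
    finally show ?thesis
      unfolding geometric[OF n] \<rho>_def[symmetric] by (simp add: left_diff_distrib)
  qed
  have "(\<lambda>x. real (Suc x) * \<rho> ^ x) sums (1 / (1 - \<rho>)\<^sup>2)"
    using r unfolding \<rho>_def[symmetric] by (intro geometric_deriv_sums) simp
  from sums_mult[OF this, of "(1 - \<rho>) * \<rho>"]
  have "(\<lambda>x. real (Suc x) * prob {\<omega> \<in> space Q. AL n \<omega> = Suc x}) sums (\<rho> / (1 - \<rho>))"
    using r unfolding \<rho>_def[symmetric] by (simp add: point power2_eq_square mult_ac del: of_nat_Suc)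
  from sums_Suc[OF this] have "(\<lambda>x. real x * prob {\<omega> \<in> space Q. AL n \<omega> = x}) sums (\<rho> / (1 - \<rho>))"
    by simp
  from expectation_nat_sums[OF rv _ this]
  show "integrable Q (\<lambda>\<omega>. real (AL n \<omega>))"
    and "expectation (\<lambda>\<omega>. real (AL n \<omega>)) = (k 1 / k n) / (1 - k 1 / k n)"
    by (simp_all add: \<rho>_def)
qed

lemma (in auxiliary_variables) mean_aux_sum:
  assumes "\<And>n. n \<in> {f1<..fm} \<Longrightarrow> 0 < k 1 / k n \<and> k 1 / k n < 1"
  shows "expectation (aux_sum fm f1 AL) = (\<Sum>n\<in>{f1<..fm}. (k 1 / k n) / (1 - k 1 / k n))"
proof -
  have "expectation (aux_sum fm f1 AL) = (\<Sum>n\<in>{f1<..fm}. expectation (\<lambda>\<omega>. real (AL n \<omega>)))"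
    unfolding aux_sum_def using assms mean_geometric(1)
    by (intro Bochner_Integration.integral_sum) auto
  also have "\<dots> = (\<Sum>n\<in>{f1<..fm}. (k 1 / k n) / (1 - k 1 / k n))"
    using assms mean_geometric(2) by (intro sum.cong) auto
  finally show ?thesis .
qed

text \<open>
  Envelope argument: for \<open>x\<close> near \<open>x0\<close> the maximizer \<open>\<theta>\<close> of \<open>- \<theta> * x - \<Lambda> \<theta>\<close> lies within \<open>\<epsilon>\<close> of \<open>t\<close>.
\<close>

lemma rate_function_has_derivative:
  fixes \<Lambda> G :: "real \<Rightarrow> real"
  assumes deriv: "\<And>\<theta>. \<theta> > 0 \<Longrightarrow> (\<Lambda> has_real_derivative - G \<theta>) (at \<theta>)"
    and cont: "continuous_on {0..} \<Lambda>"
    and anti: "\<And>a b. 0 \<le> a \<Longrightarrow> a \<le> b \<Longrightarrow> G b \<le> G a"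
    and t: "t > 0" and at: "G t = x0"
    and below: "\<And>s. 0 \<le> s \<Longrightarrow> s < t \<Longrightarrow> x0 < G s" and above: "\<And>s. t < s \<Longrightarrow> G s < x0"
  shows "(rate_function \<Lambda> has_real_derivative - t) (at x0)"
proof -
  define h where "h x \<theta> = - \<theta> * x - \<Lambda> \<theta>" for x \<theta>
  have h_deriv: "(h x has_real_derivative G \<theta> - x) (at \<theta>)" if "\<theta> > 0" for x \<theta>
    unfolding h_def by (auto intro!: derivative_eq_intros deriv that)
  have h_cont: "continuous_on {a..b} (h x)" if "0 \<le> a" for a b x
    unfolding h_def using that by (intro continuous_intros continuous_on_subset[OF cont]) auto
  \<comment> \<open>The sign of the derivative G theta - x is decided at one endpoint by
    antitonicity. Since \<open>deriv\<close> covers only theta > 0, the endpoint 0 is handled by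
    continuity.\<close>
  have h_dec: "h x b \<le> h x a" if "0 \<le> a" "a \<le> b" "G a \<le> x" for a b x
  proof (rule DERIV_nonpos_imp_decreasing_open[OF that(2)])
    fix \<theta> assume "a < \<theta>" "\<theta> < b"
    with h_deriv[of \<theta> x] anti[of a \<theta>] that show "\<exists>y. (h x has_real_derivative y) (at \<theta>) \<and> y \<le> 0"
      by (intro exI[of _ "G \<theta> - x"]) auto
  qed (rule h_cont[OF that(1)])
  have h_inc: "h x a \<le> h x b" if "0 \<le> a" "a \<le> b" "x \<le> G b" for a b x
  proof (rule DERIV_nonneg_imp_increasing_open[OF that(2)])
    fix \<theta> assume "a < \<theta>" "\<theta> < b"
    with h_deriv[of \<theta> x] anti[of \<theta> b] that show "\<exists>y. (h x has_real_derivative y) (at \<theta>) \<and> 0 \<le> y"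
      by (intro exI[of _ "G \<theta> - x"]) auto
  qed (rule h_cont[OF that(1)])
  have bound: "h x \<theta> \<le> h x t + \<epsilon> * \<bar>x - x0\<bar>"
    if \<theta>: "\<theta> \<ge> 0" and \<epsilon>: "0 < \<epsilon>" "\<epsilon> < t" and x: "G (t + \<epsilon>) < x" "x < G (t - \<epsilon>)" for x \<theta> \<epsilon>
  proof -
    \<comment> \<open>Replacing x0 by x changes h s - h t by (t - s) (x - x0), which is small in
      this window, and t maximizes \<open>h x0\<close>.\<close>
    have local: "h x s \<le> h x t + \<epsilon> * \<bar>x - x0\<bar>" if s: "t - \<epsilon> \<le> s" "s \<le> t + \<epsilon>" for s
    proof -
      have "(t - s) * (x - x0) \<le> \<bar>t - s\<bar> * \<bar>x - x0\<bar>"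
        by (metis abs_ge_self abs_mult)
      also have "\<dots> \<le> \<epsilon> * \<bar>x - x0\<bar>" using s by (intro mult_right_mono) auto
      finally have "(t - s) * (x - x0) \<le> \<epsilon> * \<bar>x - x0\<bar>" .
      moreover have "h x0 s \<le> h x0 t"
      proof (cases "s \<le> t")
        case True
        then show ?thesis using s \<epsilon> at by (intro h_inc) auto
      next
        case False
        then show ?thesis using t at by (intro h_dec) auto
      qed
      ultimately show ?thesis by (simp add: h_def algebra_simps)
    qed
    \<comment> \<open>Outside the window the value is dominated by that at the nearer window
      endpoint, by the conditions on G at t - epsilon and t + epsilon.\<close>
    consider "\<theta> < t - \<epsilon>" | "t - \<epsilon> \<le> \<theta>" "\<theta> \<le> t + \<epsilon>" | "t + \<epsilon> < \<theta>" by linarith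
    then show ?thesis
    proof cases
      case 1
      then have "h x \<theta> \<le> h x (t - \<epsilon>)" using \<theta> x by (intro h_inc) auto
      then show ?thesis using local[of "t - \<epsilon>"] \<epsilon> by linarith
    next
      case 3
      then have "h x \<theta> \<le> h x (t + \<epsilon>)" using t \<epsilon> x by (intro h_dec) auto
      then show ?thesis using local[of "t + \<epsilon>"] \<epsilon> by linarith
    qed (rule local)
  qed
  have rate: "h x t \<le> rate_function \<Lambda> x \<and> rate_function \<Lambda> x \<le> h x t + \<epsilon> * \<bar>x - x0\<bar>"
    if "0 < \<epsilon>" "\<epsilon> < t" "G (t + \<epsilon>) < x" "x < G (t - \<epsilon>)" for x \<epsilon>
    unfolding rate_function_def h_def[symmetric]
  proof
    show "h x t \<le> (SUP \<theta>\<in>{0..}. h x \<theta>)"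
      using t bound[OF _ that] by (intro cSUP_upper) (auto intro!: bdd_aboveI)
    show "(SUP \<theta>\<in>{0..}. h x \<theta>) \<le> h x t + \<epsilon> * \<bar>x - x0\<bar>"
      using bound[OF _ that] by (intro cSUP_least) auto
  qed
  \<comment> \<open>At x = x0 the error term is zero, so a single admissible epsilon gives
    equality.\<close>
  have at_x0: "rate_function \<Lambda> x0 = h x0 t"
    using rate[of "t / 2" x0] t below[of "t / 2"] above[of "t + t / 2"] by auto
  show ?thesis
    unfolding has_field_derivative_iff
  proof (rule tendstoI)
    fix e :: real assume e: "e > 0"
    define \<epsilon> where "\<epsilon> = min (e / 2) (t / 2)"
    have \<epsilon>: "0 < \<epsilon>" "\<epsilon> < t" "\<epsilon> < e" using e t by (auto simp: \<epsilon>_def)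
    have "\<forall>\<^sub>F x in at x0. x \<in> {G (t + \<epsilon>)<..<G (t - \<epsilon>)}"
      using below[of "t - \<epsilon>"] above[of "t + \<epsilon>"] \<epsilon> by (intro eventually_at_in_open') auto
    moreover have "\<forall>\<^sub>F x in at x0. x \<noteq> x0"
      by (simp add: eventually_at_filter)
    ultimately show "\<forall>\<^sub>F x in at x0. dist ((rate_function \<Lambda> x - rate_function \<Lambda> x0) / (x - x0)) (- t) < e"
    proof eventually_elim
      case (elim x)
      \<comment> \<open>Since h x t - h x0 t = -t (x - x0), the squeeze \<open>rate\<close> bounds
        exactly the remainder of the linear approximation.\<close>
      have "\<bar>rate_function \<Lambda> x - rate_function \<Lambda> x0 + t * (x - x0)\<bar> \<le> \<epsilon> * \<bar>x - x0\<bar>"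
        using rate[of \<epsilon> x] \<epsilon> elim by (auto simp: at_x0 h_def algebra_simps)
      also have "\<dots> < e * \<bar>x - x0\<bar>" using \<epsilon> elim by (intro mult_strict_right_mono) auto
      finally have "\<bar>(rate_function \<Lambda> x - rate_function \<Lambda> x0 + t * (x - x0)) / (x - x0)\<bar> < e"
        using elim by (simp add: abs_divide field_simps)
      moreover have "(rate_function \<Lambda> x - rate_function \<Lambda> x0 + t * (x - x0)) / (x - x0)
          = (rate_function \<Lambda> x - rate_function \<Lambda> x0) / (x - x0) - (- t)"
        using elim by (simp add: field_simps)
      ultimately show ?case by (simp add: dist_real_def)
    qed
  qed
qed

section \<open>The supercritical limit\<close>

lemma shifted_ratio_limit: "(\<lambda>m. real (m - a + b) / real m) \<longlonglongrightarrow> 1"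
proof -
  have "(\<lambda>m. 1 + (real b - real a) / real m) \<longlonglongrightarrow> 1 + 0"
    by (intro tendsto_add tendsto_const lim_const_over_n)
  moreover have "\<forall>\<^sub>F m in sequentially. 1 + (real b - real a) / real m = real (m - a + b) / real m"
    using eventually_ge_at_top[of "Suc a"]
    by eventually_elim (simp add: field_simps of_nat_diff)
  ultimately show ?thesis
    using Lim_transform_eventually by fastforce
qed

text \<open>These are the hypotheses after evaluating the means: kappa_1 is the mean of the Poisson
  variable, and a geometric variable of class j has mean varrho_j / (1 - varrho_j), so the sum is
  the limit of E S / m.\<close>

locale filament_limit = filament_model +
  fixes fbar :: "nat \<Rightarrow> real" and \<kappa>bar :: real
  assumes first_class_small: "(\<lambda>m. real (class_size f \<kappa> varkappa m 1) / real m) \<longlonglongrightarrow> 0"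
    and kappa_limit: "(\<lambda>m. \<kappa> m 1 / real m) \<longlonglongrightarrow> \<kappa>bar"
    and kappa_bar_nonneg: "\<kappa>bar \<ge> 0"
    and class_fractions: "\<And>j. j \<in> {2..K} \<Longrightarrow>
      (\<lambda>m. real (class_size f \<kappa> varkappa m j) / real m) \<longlonglongrightarrow> fbar j"
    and fbar_nonneg: "\<And>j. j \<in> {2..K} \<Longrightarrow> fbar j \<ge> 0"
    and supercritical: "\<kappa>bar + (\<Sum>j=2..K. fbar j * (varrho j / (1 - varrho j))) > 1"
begin

section \<open>The limiting function and its root\<close>

definition g :: "real \<Rightarrow> real" where
  "g x = \<kappa>bar * x + (\<Sum>j=2..K. fbar j * (varrho j * x / (1 - varrho j * x)))"

lemma varrho_mult_less_1:
  assumes "j \<in> {2..K}" "x \<le> 1"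
  shows "varrho j * x < 1"
proof -
  have "varrho j * x \<le> varrho j * 1"
    using assms varrho_bounds[of j] by (intro mult_left_mono) auto
  then show ?thesis using varrho_bounds[OF assms(1)] by linarith
qed

text \<open>
  That \<open>g x / x\<close> increases replaces strict monotonicity of \<open>g\<close>: it forces \<open>g y < 1\<close> below the root and
  \<open>g y > 1\<close> above it.
\<close>

lemma g_mono_quotient:
  assumes "0 \<le> x" "x \<le> y" "y \<le> 1"
  shows "g x * y \<le> g y * x"
proof -
  have "fbar j * (varrho j * x / (1 - varrho j * x)) * y \<le> fbar j * (varrho j * y / (1 - varrho j * y)) * x"
    if j: "j \<in> {2..K}" for j
  proof -
    have "varrho j * x \<le> varrho j * y" "varrho j * y < 1"
      using assms varrho_bounds[OF j] varrho_mult_less_1[OF j, of y] by auto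
    then have "fbar j * varrho j * x * y / (1 - varrho j * x) \<le> fbar j * varrho j * x * y / (1 - varrho j * y)"
      using assms varrho_bounds[OF j] fbar_nonneg[OF j]
      by (intro divide_left_mono mult_pos_pos mult_nonneg_nonneg) (linarith | assumption)+
    then show ?thesis by (simp add: mult_ac)
  qed
  then show ?thesis
    unfolding g_def distrib_right sum_distrib_right by (intro add_mono sum_mono) (auto simp: mult_ac)
qed

lemma continuous_on_g: "continuous_on {..1} g"
  unfolding g_def using varrho_mult_less_1 by (intro continuous_intros) force

lemma g_nonneg:
  assumes "0 \<le> x" "x \<le> 1"
  shows "g x \<ge> 0"
proof -
  have "0 \<le> fbar j * (varrho j * x / (1 - varrho j * x))" if j: "j \<in> {2..K}" for j
    using fbar_nonneg[OF j] varrho_bounds[OF j] varrho_mult_less_1[OF j assms(2)] assms(1) by simp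
  then show ?thesis
    unfolding g_def using kappa_bar_nonneg assms(1) by (intro add_nonneg_nonneg sum_nonneg) auto
qed

text \<open>Supercriticality enters here: g 0 = 0 < 1 < g 1, and the intermediate value theorem
  applies.\<close>

lemma ex_root_g: "\<exists>x. 0 < x \<and> x < 1 \<and> g x = 1"
proof -
  have "g 0 = 0" "g 1 > 1" using supercritical by (simp_all add: g_def)
  then obtain x where x: "0 \<le> x" "x \<le> 1" "g x = 1"
    using IVT'[of g 0 1 1] continuous_on_subset[OF continuous_on_g, of "{0..1}"] by auto
  moreover have "x \<noteq> 0" "x \<noteq> 1"
    using x \<open>g 0 = 0\<close> \<open>g 1 > 1\<close> by auto
  ultimately show ?thesis by (intro exI[of _ x]) linarith
qed

lemma kappa_ratio_bounds:
  assumes "m \<ge> 1" "n \<in> {1..f m}"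
  shows "0 < \<kappa> m 1 / \<kappa> m n" "\<kappa> m 1 / \<kappa> m n \<le> 1"
proof -
  have "1 \<in> {1..f m}" using filaments[OF assms(1)] by simp
  then show "0 < \<kappa> m 1 / \<kappa> m n" "\<kappa> m 1 / \<kappa> m n \<le> 1"
    using assms kappa_pos[OF assms(1)] mono_onD[OF kappa_mono[OF assms(1)], of 1 n] by auto
qed

lemma sum_all_classes:
  fixes F :: "real \<Rightarrow> real"
  assumes m: "m \<ge> 1"
  shows "(\<Sum>n=1..f m. F (\<kappa> m 1 / \<kappa> m n))
       = real (class_size f \<kappa> varkappa m 1) * F 1
         + (\<Sum>j=2..K. real (class_size f \<kappa> varkappa m j) * F (varrho j))"
proof -
  let ?f1 = "class_size f \<kappa> varkappa m 1"
  have first: "{1..?f1} \<subseteq> {1..f m}" "\<And>n. n \<in> {1..?f1} \<Longrightarrow> \<kappa> m n = \<kappa> m 1"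
    unfolding first_class[OF m, symmetric] kappa_first[OF m] by blast+
  have split: "{1..f m} = {1..?f1} \<union> {?f1<..f m}"
    using first(1) by auto
  have "(\<Sum>n=1..f m. F (\<kappa> m 1 / \<kappa> m n))
      = (\<Sum>n=1..?f1. F (\<kappa> m 1 / \<kappa> m n)) + (\<Sum>n\<in>{?f1<..f m}. F (\<kappa> m 1 / \<kappa> m n))"
    unfolding split by (rule sum.union_disjoint) auto
  also have "(\<Sum>n=1..?f1. F (\<kappa> m 1 / \<kappa> m n)) = (\<Sum>n=1..?f1. F 1)"
  proof (rule sum.cong[OF refl])
    fix n assume "n \<in> {1..?f1}"
    then have "\<kappa> m n = \<kappa> m 1" by (rule first(2))
    then show "F (\<kappa> m 1 / \<kappa> m n) = F 1"
      using kappa_pos[OF m, of 1] filaments[OF m] by simp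
  qed
  finally show ?thesis
    unfolding sum_other_classes[OF m, of F] by simp
qed

text \<open>The first class has ratio 1 and contributes \<open>F 1\<close> times f_1/m, which tends
  to 0. Since F is fixed in m, only the class fractions vary.\<close>

lemma class_average_limit:
  fixes F :: "real \<Rightarrow> real"
  shows "(\<lambda>m. (\<kappa> m 1 * y + (\<Sum>n=1..f m. F (\<kappa> m 1 / \<kappa> m n))) / real m)
    \<longlonglongrightarrow> \<kappa>bar * y + (\<Sum>j=2..K. fbar j * F (varrho j))"
proof -
  have "(\<lambda>m. \<kappa> m 1 / real m * y + (real (class_size f \<kappa> varkappa m 1) / real m * F 1
          + (\<Sum>j=2..K. real (class_size f \<kappa> varkappa m j) / real m * F (varrho j))))
      \<longlonglongrightarrow> \<kappa>bar * y + (0 * F 1 + (\<Sum>j=2..K. fbar j * F (varrho j)))"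
    by (intro tendsto_intros kappa_limit first_class_small class_fractions)
  moreover have "\<forall>\<^sub>F m in sequentially. \<kappa> m 1 / real m * y + (real (class_size f \<kappa> varkappa m 1) / real m * F 1
          + (\<Sum>j=2..K. real (class_size f \<kappa> varkappa m j) / real m * F (varrho j)))
       = (\<kappa> m 1 * y + (\<Sum>n=1..f m. F (\<kappa> m 1 / \<kappa> m n))) / real m"
    using eventually_ge_at_top[of "1::nat"]
  proof eventually_elim
    case (elim m)
    show ?case
      unfolding sum_all_classes[OF elim, of F] by (simp add: add_divide_distrib sum_divide_distrib)
  qed
  ultimately show ?thesis
    using Lim_transform_eventually by fastforce
qed

section \<open>Convergence of the coefficient ratios\<close>

definition W :: "nat \<Rightarrow> nat \<Rightarrow> real" where
  "W m = fps_nth (gen_fun (\<kappa> m 1) (\<lambda>n. \<kappa> m 1 / \<kappa> m n) {1..f m})"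

text \<open>Contrapositive of \<open>gen_fun_ratio_le\<close> at r = m - Suc l: divided by m, its
  two sides tend to 1 and to g y < 1. As y < 1, the summand stays finite even for ratio 1.\<close>

lemma W_ratio_eventually_gt:
  assumes y: "0 < y" "y < 1" "g y < 1"
  shows "\<forall>\<^sub>F m in sequentially. y < W m (m - Suc l) / W m (m - l)"
proof -
  have "(\<lambda>m. (\<kappa> m 1 * y + (\<Sum>n=1..f m. \<kappa> m 1 / \<kappa> m n * y / (1 - \<kappa> m 1 / \<kappa> m n * y))) / real m)
      \<longlonglongrightarrow> g y"
    unfolding g_def by (rule class_average_limit)
  moreover have "(\<lambda>m. real (m - l) / real m) \<longlonglongrightarrow> 1"
    using shifted_ratio_limit[of l 0] by simp
  ultimately have "(\<lambda>m. real (m - l) / real m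
      - (\<kappa> m 1 * y + (\<Sum>n=1..f m. \<kappa> m 1 / \<kappa> m n * y / (1 - \<kappa> m 1 / \<kappa> m n * y))) / real m)
      \<longlonglongrightarrow> 1 - g y"
    by (intro tendsto_diff)
  then have "\<forall>\<^sub>F m in sequentially. 0 < real (m - l) / real m
      - (\<kappa> m 1 * y + (\<Sum>n=1..f m. \<kappa> m 1 / \<kappa> m n * y / (1 - \<kappa> m 1 / \<kappa> m n * y))) / real m"
    by (rule order_tendstoD(1)) (use y in simp)
  then show ?thesis
    using eventually_ge_at_top[of "Suc l"]
  proof eventually_elim
    case (elim m)
    then have m: "m \<ge> 1" and eq: "m - l = Suc (m - Suc l)" by auto
    have "(\<kappa> m 1 * y + (\<Sum>n=1..f m. \<kappa> m 1 / \<kappa> m n * y / (1 - \<kappa> m 1 / \<kappa> m n * y))) < real (m - l)"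
      using elim(1) m by (simp add: field_simps)
    moreover have "0 \<le> \<kappa> m 1 / \<kappa> m n \<and> \<kappa> m 1 / \<kappa> m n * y < 1" if "n \<in> {1..f m}" for n
      using kappa_ratio_bounds[OF m that] y by (smt (verit) mult_left_le_one_le)
    ultimately show ?case
      using gen_fun_ratio_le[of "{1..f m}" "\<kappa> m 1" "\<lambda>n. \<kappa> m 1 / \<kappa> m n" y "m - Suc l"]
        kappa_pos[OF m, of 1] filaments[OF m]
      unfolding W_def eq by force
  qed
qed

text \<open>Contrapositive of \<open>gen_fun_ratio_ge\<close>. N is chosen first, so large that the
  truncated g already exceeds 1 at y; for fixed N the shift by N disappears after division by
  m.\<close>

lemma W_ratio_eventually_lt:
  assumes y: "0 < y" "y < 1" "g y > 1"
  shows "\<forall>\<^sub>F m in sequentially. W m (m - Suc l) / W m (m - l) < y"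
proof -
  have "(\<lambda>N. \<kappa>bar * y + (\<Sum>j=2..K. fbar j * (\<Sum>k=1..N. (varrho j * y) ^ k))) \<longlonglongrightarrow> g y"
    unfolding g_def
  proof (intro tendsto_intros)
    fix j assume j: "j \<in> {2..K}"
    have "\<bar>varrho j * y\<bar> < 1"
      using varrho_mult_less_1[OF j, of y] varrho_bounds[OF j] y by auto
    then have "(\<lambda>k. (varrho j * y) * (varrho j * y) ^ k) sums (varrho j * y * (1 / (1 - varrho j * y)))"
      by (intro sums_mult geometric_sums) simp
    then show "(\<lambda>N. \<Sum>k=1..N. (varrho j * y) ^ k) \<longlonglongrightarrow> varrho j * y / (1 - varrho j * y)"
      by (simp add: sums_def sum.atLeast1_atMost_eq)
  qed
  then have "\<forall>\<^sub>F N in sequentially. 1 < \<kappa>bar * y + (\<Sum>j=2..K. fbar j * (\<Sum>k=1..N. (varrho j * y) ^ k))"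
    by (rule order_tendstoD(1)) (use y in simp)
  then have "\<forall>\<^sub>F N in sequentially. N \<ge> 1 \<and>
      1 < \<kappa>bar * y + (\<Sum>j=2..K. fbar j * (\<Sum>k=1..N. (varrho j * y) ^ k))"
    using eventually_ge_at_top[of "1::nat"] by eventually_elim auto
  then obtain N where N: "N \<ge> 1"
      "1 < \<kappa>bar * y + (\<Sum>j=2..K. fbar j * (\<Sum>k=1..N. (varrho j * y) ^ k))"
    using eventually_happens'[OF sequentially_bot] by blast
  have "(\<lambda>m. (\<kappa> m 1 * y + (\<Sum>n=1..f m. \<Sum>k=1..N. (\<kappa> m 1 / \<kappa> m n * y) ^ k)) / real m)
      \<longlonglongrightarrow> \<kappa>bar * y + (\<Sum>j=2..K. fbar j * (\<Sum>k=1..N. (varrho j * y) ^ k))"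
    by (rule class_average_limit)
  moreover have "(\<lambda>m. real (m - Suc l + N) / real m) \<longlonglongrightarrow> 1"
    by (rule shifted_ratio_limit)
  ultimately have "(\<lambda>m. (\<kappa> m 1 * y + (\<Sum>n=1..f m. \<Sum>k=1..N. (\<kappa> m 1 / \<kappa> m n * y) ^ k)) / real m
      - real (m - Suc l + N) / real m)
      \<longlonglongrightarrow> \<kappa>bar * y + (\<Sum>j=2..K. fbar j * (\<Sum>k=1..N. (varrho j * y) ^ k)) - 1"
    by (intro tendsto_diff)
  then have "\<forall>\<^sub>F m in sequentially.
      0 < (\<kappa> m 1 * y + (\<Sum>n=1..f m. \<Sum>k=1..N. (\<kappa> m 1 / \<kappa> m n * y) ^ k)) / real m
          - real (m - Suc l + N) / real m"
    by (rule order_tendstoD(1)) (use N(2) in simp)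
  then show ?thesis
    using eventually_ge_at_top[of "Suc l"]
  proof eventually_elim
    case (elim m)
    then have m: "m \<ge> 1" and eq: "m - l = Suc (m - Suc l)" by auto
    have "real (m - Suc l + N) < \<kappa> m 1 * y + (\<Sum>n=1..f m. \<Sum>k=1..N. (\<kappa> m 1 / \<kappa> m n * y) ^ k)"
    proof -
      have "real (m - Suc l + N) / real m
          < (\<kappa> m 1 * y + (\<Sum>n=1..f m. \<Sum>k=1..N. (\<kappa> m 1 / \<kappa> m n * y) ^ k)) / real m"
        using elim(1) by linarith
      moreover have "real m > 0" using m by simp
      ultimately show ?thesis by (auto simp only: divide_less_cancel)
    qed
    moreover have "0 \<le> \<kappa> m 1 / \<kappa> m n" if "n \<in> {1..f m}" for n
      using kappa_ratio_bounds[OF m that] by simp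
    ultimately show ?case
      using gen_fun_ratio_ge[of "{1..f m}" "\<kappa> m 1" "\<lambda>n. \<kappa> m 1 / \<kappa> m n" N y "m - Suc l"]
        kappa_pos[OF m, of 1] filaments[OF m] N(1) y
      unfolding W_def eq by force
  qed
qed

lemma W_ratio_limit:
  assumes x: "0 < x" "x < 1" "g x = 1"
  shows "(\<lambda>m. W m (m - Suc l) / W m (m - l)) \<longlonglongrightarrow> x"
proof (rule order_tendstoI)
  fix a assume "a < x"
  \<comment> \<open>\<open>max a 0\<close> keeps y positive. Then g y * x <= g x * y = y < x forces
    g y < 1; the other half is symmetric, with \<open>min a 1\<close> keeping y below 1.\<close>
  then obtain y where y: "max a 0 < y" "y < x"
    using dense[of "max a 0" x] x by auto
  have "g y * x \<le> y" using g_mono_quotient[of y x] x y by simp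
  then have "g y * x < 1 * x" using y by linarith
  then have "g y < 1" by (rule mult_right_less_imp_less) (use x in simp)
  then have "\<forall>\<^sub>F m in sequentially. y < W m (m - Suc l) / W m (m - l)"
    using x y by (intro W_ratio_eventually_gt) auto
  then show "\<forall>\<^sub>F m in sequentially. a < W m (m - Suc l) / W m (m - l)"
    by eventually_elim (use y in auto)
next
  fix a assume "x < a"
  then obtain y where y: "x < y" "y < min a 1"
    using dense[of x "min a 1"] x by auto
  have "y \<le> g y * x" using g_mono_quotient[of x y] x y by simp
  then have "1 * x < g y * x" using y by linarith
  then have "1 < g y" by (rule mult_right_less_imp_less) (use x in simp)
  then have "\<forall>\<^sub>F m in sequentially. W m (m - Suc l) / W m (m - l) < y"
    using x y by (intro W_ratio_eventually_lt) auto
  then show "\<forall>\<^sub>F m in sequentially. W m (m - Suc l) / W m (m - l) < a"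
    by eventually_elim (use y in auto)
qed

lemma W_positive:
  assumes "m \<ge> 1"
  shows "W m r > 0"
proof -
  have "log_concave (W m)"
    unfolding W_def using assms kappa_pos[OF assms, of 1] filaments[OF assms] kappa_ratio_bounds[OF assms]
    by (intro log_concave_gen_fun) (auto simp: less_imp_le)
  then show ?thesis by (simp add: log_concave_def)
qed

text \<open>The quotient telescopes into a fixed number l of consecutive ratios, each tending to
  x.\<close>

lemma W_quotient_limit:
  assumes x: "0 < x" "x < 1" "g x = 1"
  shows "(\<lambda>m. W m (m - l) / W m m) \<longlonglongrightarrow> x ^ l"
proof (induction l)
  case 0
  have "\<forall>\<^sub>F m in sequentially. W m (m - 0) / W m m = 1"
    using eventually_ge_at_top[of "1::nat"] by eventually_elim (simp add: less_imp_neq[OF W_positive, symmetric])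
  then show ?case by (simp add: tendsto_eventually)
next
  case (Suc l)
  have "(\<lambda>m. W m (m - Suc l) / W m (m - l) * (W m (m - l) / W m m)) \<longlonglongrightarrow> x * x ^ l"
    by (intro tendsto_mult W_ratio_limit[OF x] Suc)
  moreover have "\<forall>\<^sub>F m in sequentially.
      W m (m - Suc l) / W m (m - l) * (W m (m - l) / W m m) = W m (m - Suc l) / W m m"
    using eventually_ge_at_top[of "1::nat"]
  proof eventually_elim
    case (elim m)
    then show ?case using W_positive[of m "m - l"] by simp
  qed
  ultimately show ?case
    using Lim_transform_eventually by fastforce
qed

section \<open>Limits of filament lengths and of the monomer fraction\<close>

lemma length_tail_limit:
  assumes x: "0 < x" "x < 1" "g x = 1"
    and lengths: "\<And>m. m \<ge> 1 \<Longrightarrow> stationary_lengths (P m) m (f m) (\<kappa> m) (L m)"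
    and j: "j \<in> {1..K}" and i: "\<And>m. m \<ge> 1 \<Longrightarrow> i m \<in> {1..f m} \<and> \<kappa> m (i m) = varkappa m j"
  shows "(\<lambda>m. measure (P m) {\<omega> \<in> space (P m). L m (i m) \<omega> \<ge> l}) \<longlonglongrightarrow> (varrho j * x) ^ l"
proof -
  have "(\<lambda>m. varrho j ^ l * (W m (m - l) / W m m)) \<longlonglongrightarrow> varrho j ^ l * x ^ l"
    by (intro tendsto_intros W_quotient_limit x)
  moreover have "\<forall>\<^sub>F m in sequentially. varrho j ^ l * (W m (m - l) / W m m)
      = measure (P m) {\<omega> \<in> space (P m). L m (i m) \<omega> \<ge> l}"
    using eventually_ge_at_top[of "Suc l"]
  proof eventually_elim
    case (elim m)
    then have m: "m \<ge> 1" "l \<le> m" by auto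
    interpret stationary_lengths "P m" m "f m" "\<kappa> m" "L m" by (rule lengths[OF m(1)])
    have "\<kappa> m 1 / \<kappa> m (i m) = varrho j"
      using i[OF m(1)] ratios[OF m(1) j] kappa_first[OF m(1)] by simp
    then show ?case
      using length_tail[OF kappa_pos[OF m(1)] filaments[OF m(1)], of "i m" l] i[OF m(1)] m
      by (simp add: W_def)
  qed
  ultimately have "(\<lambda>m. measure (P m) {\<omega> \<in> space (P m). L m (i m) \<omega> \<ge> l}) \<longlonglongrightarrow> varrho j ^ l * x ^ l"
    by (rule Lim_transform_eventually)
  then show ?thesis by (simp add: power_mult_distrib)
qed

text \<open>W(m-2)/W(m) tends to x^2, the square of the limit of W(m-1)/W(m), so with centre
  kappabar x the quadratic terms of the deviation bound cancel. The remaining term carries an extra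
  factor 1/m.\<close>

lemma monomers_limit:
  assumes x: "0 < x" "x < 1" "g x = 1"
    and lengths: "\<And>m. m \<ge> 1 \<Longrightarrow> stationary_lengths (P m) m (f m) (\<kappa> m) (L m)"
    and \<epsilon>: "\<epsilon> > 0"
  shows "(\<lambda>m. measure (P m) {\<omega> \<in> space (P m).
            \<bar>monomers m (f m) (L m) \<omega> / real m - \<kappa>bar * x\<bar> > \<epsilon>}) \<longlonglongrightarrow> 0"
proof (rule tendsto_sandwich[OF _ _ tendsto_const])
  let ?y = "\<kappa>bar * x"
  let ?c = "\<lambda>m. \<kappa> m 1 / real m" and ?u = "\<lambda>m. W m (m - 1) / W m m" and ?v = "\<lambda>m. W m (m - 2) / W m m"
  let ?B = "\<lambda>m. (?c m * ?u m / real m + ?c m ^ 2 * ?v m - 2 * ?y * (?c m * ?u m) + ?y ^ 2) / \<epsilon> ^ 2"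
  have "(\<lambda>m. ?c m * ?u m / real m) \<longlonglongrightarrow> 0"
    by (rule real_tendsto_divide_at_top[OF tendsto_mult[OF kappa_limit W_quotient_limit[OF x]]])
       (rule filterlim_real_sequentially)
  then have "?B \<longlonglongrightarrow> (0 + \<kappa>bar ^ 2 * x ^ 2 - 2 * ?y * (\<kappa>bar * x ^ 1) + ?y ^ 2) / \<epsilon> ^ 2"
    using \<epsilon> by (intro tendsto_intros kappa_limit W_quotient_limit x) auto
  also have "(0 + \<kappa>bar ^ 2 * x ^ 2 - 2 * ?y * (\<kappa>bar * x ^ 1) + ?y ^ 2) / \<epsilon> ^ 2 = 0"
    by (simp add: power2_eq_square)
  finally show "?B \<longlonglongrightarrow> 0" .
  show "\<forall>\<^sub>F m in sequentially. measure (P m) {\<omega> \<in> space (P m).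
            \<bar>monomers m (f m) (L m) \<omega> / real m - ?y\<bar> > \<epsilon>} \<le> ?B m"
    using eventually_ge_at_top[of 2]
  proof eventually_elim
    case (elim m)
    then have m: "m \<ge> 1" by simp
    interpret stationary_lengths "P m" m "f m" "\<kappa> m" "L m" by (rule lengths[OF m])
    show ?case
      unfolding W_def by (rule monomers_deviation[OF kappa_pos[OF m] filaments[OF m] elim \<epsilon>])
  qed
qed auto

section \<open>Derivatives of the limiting log-Laplace transform and of the rate function\<close>

definition limit_log_laplace :: "real \<Rightarrow> real" where
  "limit_log_laplace \<theta> = - \<kappa>bar * (1 - exp (- \<theta>))
     + (\<Sum>j=2..K. fbar j * ln ((1 - varrho j) / (1 - varrho j * exp (- \<theta>))))"

lemma limit_log_laplace_deriv:
  assumes "\<theta> \<ge> 0"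
  shows "(limit_log_laplace has_real_derivative - g (exp (- \<theta>))) (at \<theta>)"
proof -
  have "((\<lambda>\<theta>. fbar j * ln ((1 - varrho j) / (1 - varrho j * exp (- \<theta>)))) has_real_derivative
          - (fbar j * (varrho j * exp (- \<theta>) / (1 - varrho j * exp (- \<theta>))))) (at \<theta>)"
    if j: "j \<in> {2..K}" for j
  proof -
    define D where "D s = 1 - varrho j * exp (- s)" for s
    \<comment> \<open>The bound exp (- theta) <= 1 includes theta = 0, where the two-sided
      derivative exists because varrho_j < 1.\<close>
    have pos: "1 - varrho j > 0" "D \<theta> > 0"
      using varrho_mult_less_1[OF j, of "exp (- \<theta>)"] varrho_bounds[OF j] assms by (auto simp: D_def)
    have "(D has_real_derivative varrho j * exp (- \<theta>)) (at \<theta>)"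
      unfolding D_def[abs_def] by (auto intro!: derivative_eq_intros)
    then have "((\<lambda>s. fbar j * ln ((1 - varrho j) / D s)) has_real_derivative
        - (fbar j * (varrho j * exp (- \<theta>) / D \<theta>))) (at \<theta>)"
      using pos by (auto intro!: derivative_eq_intros simp: field_simps)
    then show ?thesis unfolding D_def .
  qed
  then have "((\<lambda>\<theta>. \<Sum>j=2..K. fbar j * ln ((1 - varrho j) / (1 - varrho j * exp (- \<theta>))))
      has_real_derivative (\<Sum>j=2..K. - (fbar j * (varrho j * exp (- \<theta>) / (1 - varrho j * exp (- \<theta>)))))) (at \<theta>)"
    by (rule DERIV_sum)
  moreover have "((\<lambda>\<theta>. - \<kappa>bar * (1 - exp (- \<theta>))) has_real_derivative - (\<kappa>bar * exp (- \<theta>))) (at \<theta>)"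
    by (auto intro!: derivative_eq_intros)
  ultimately have "(limit_log_laplace has_real_derivative - (\<kappa>bar * exp (- \<theta>))
      + (\<Sum>j=2..K. - (fbar j * (varrho j * exp (- \<theta>) / (1 - varrho j * exp (- \<theta>)))))) (at \<theta>)"
    unfolding limit_log_laplace_def[abs_def] by (intro DERIV_add)
  then show ?thesis
    by (simp add: g_def sum_negf)
qed

text \<open>Agreement on theta >= 0 is enough because the maximizer -ln x is positive, hence
  interior. The envelope lemma is applied with G theta = g (exp (- theta)) and x0 = 1.\<close>

lemma rate_function_limit_deriv:
  assumes \<Lambda>: "\<And>\<theta>. \<theta> \<ge> 0 \<Longrightarrow> \<Lambda> \<theta> = limit_log_laplace \<theta>"
    and x: "0 < x" "x < 1" "g x = 1"
  shows "(\<Lambda> has_real_derivative - 1) (at (- ln x))"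
    and "(rate_function \<Lambda> has_real_derivative ln x) (at 1)"
proof -
  have g_anti: "g (exp (- b)) * exp (- a) \<le> g (exp (- a)) * exp (- b)" if "0 \<le> a" "a \<le> b" for a b
    using that by (intro g_mono_quotient) auto
  have deriv: "(\<Lambda> has_real_derivative - g (exp (- \<theta>))) (at \<theta>)" if "\<theta> > 0" for \<theta>
    by (rule has_field_derivative_transform_within_open[OF limit_log_laplace_deriv, of _ "{0<..}"])
       (use that \<Lambda> in auto)
  have t: "- ln x > 0" "exp (- (- ln x)) = x" using x by auto
  show "(\<Lambda> has_real_derivative - 1) (at (- ln x))"
    using deriv[OF t(1)] x t by simp
  have cont: "continuous_on {0..} \<Lambda>"
  proof -
    have "continuous_on {0..} limit_log_laplace"
      by (intro continuous_at_imp_continuous_on ballI DERIV_isCont[OF limit_log_laplace_deriv]) auto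
    then show ?thesis by (rule continuous_on_eq) (simp add: \<Lambda>)
  qed
  have "(rate_function \<Lambda> has_real_derivative - (- ln x)) (at 1)"
  proof (rule rate_function_has_derivative[OF deriv cont _ t(1)])
    fix a b :: real assume ab: "0 \<le> a" "a \<le> b"
    have "g (exp (- b)) * exp (- a) \<le> g (exp (- a)) * exp (- b)" using g_anti ab .
    \<comment> \<open>Monotonicity of the quotient yields that of g itself: exp (- b) is replaced by
      the larger exp (- a), using g >= 0.\<close>
    also have "\<dots> \<le> g (exp (- a)) * exp (- a)"
      using ab g_nonneg[of "exp (- a)"] by (intro mult_left_mono) auto
    finally show "g (exp (- b)) \<le> g (exp (- a))" by simp
  next
    show "g (exp (- (- ln x))) = 1" using t x by simp
  next
    fix s assume s: "0 \<le> s" "s < - ln x"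
    \<comment> \<open>Here g (exp (- s)) is at least exp (- s) / x, and exp (- s) > x makes the
      bound strictly larger than 1.\<close>
    then have "1 * exp (- s) \<le> g (exp (- s)) * x" using g_anti[of s "- ln x"] x by simp
    moreover have "exp (ln x) < exp (- s)" using s by simp
    then have "x < exp (- s)" using x by simp
    ultimately have "1 * x < g (exp (- s)) * x" by linarith
    then show "1 < g (exp (- s))" using x by simp
  next
    fix s assume s: "- ln x < s"
    then have "g (exp (- s)) * x \<le> exp (- s)" using g_anti[of "- ln x" s] t x by simp
    also have "exp (- s) < exp (ln x)" using s by simp
    finally show "g (exp (- s)) < 1" using x by simp
  qed
  then show "(rate_function \<Lambda> has_real_derivative ln x) (at 1)" by simp
qed

end

theorem theorem2:
  fixes K :: nat and f :: "nat \<Rightarrow> nat"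
    and \<kappa> varkappa :: "nat \<Rightarrow> nat \<Rightarrow> real" and varrho fbar :: "nat \<Rightarrow> real"
    and P :: "nat \<Rightarrow> 'a measure" and L :: "nat \<Rightarrow> nat \<Rightarrow> 'a \<Rightarrow> nat"
    and Q :: "nat \<Rightarrow> 'b measure" and AM :: "nat \<Rightarrow> 'b \<Rightarrow> nat"
    and AL :: "nat \<Rightarrow> nat \<Rightarrow> 'b \<Rightarrow> nat"
    and S :: "nat \<Rightarrow> 'b \<Rightarrow> real" and \<Lambda> ell :: "real \<Rightarrow> real"
    and \<kappa>bar sbar :: real
  assumes model: "filament_model K f \<kappa> varkappa varrho"
    and lengths: "\<And>m. m \<ge> 1 \<Longrightarrow> stationary_lengths (P m) m (f m) (\<kappa> m) (L m)"
    and aux: "\<And>m. m \<ge> 1 \<Longrightarrow>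
      auxiliary_variables (Q m) (f m) (class_size f \<kappa> varkappa m 1) (\<kappa> m) (AM m) (AL m)"
    and S_eq: "S = (\<lambda>m. aux_sum (f m) (class_size f \<kappa> varkappa m 1) (AL m))"
    and \<Lambda>_eq: "\<Lambda> = log_laplace Q (\<lambda>m \<omega>. real (AM m \<omega>) + S m \<omega>)"
    and ell_eq: "ell = rate_function \<Lambda>"
    and first_class_small: "(\<lambda>m. real (class_size f \<kappa> varkappa m 1) / real m) \<longlonglongrightarrow> 0"
    and mean_M: "(\<lambda>m. (\<integral>\<omega>. real (AM m \<omega>) \<partial>Q m) / real m) \<longlonglongrightarrow> \<kappa>bar"
    and \<kappa>bar_nonneg: "\<kappa>bar \<ge> 0"
    and mean_S: "(\<lambda>m. (\<integral>\<omega>. S m \<omega> \<partial>Q m) / real m) \<longlonglongrightarrow> sbar"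
    and sbar_nonneg: "sbar \<ge> 0"
    and supercritical: "\<kappa>bar + sbar > 1"
    and class_fractions: "\<And>j. j \<in> {2..K} \<Longrightarrow>
      (\<lambda>m. real (class_size f \<kappa> varkappa m j) / real m) \<longlonglongrightarrow> fbar j"
    and fbar_nonneg: "\<And>j. j \<in> {2..K} \<Longrightarrow> fbar j \<ge> 0"
  shows "(\<forall>j\<in>{1..K}. \<forall>i. (\<forall>m\<ge>1. i m \<in> {1..f m} \<and> \<kappa> m (i m) = varkappa m j) \<longrightarrow>
            (\<forall>l. (\<lambda>m. measure (P m) {\<omega> \<in> space (P m). L m (i m) \<omega> \<ge> l})
                   \<longlonglongrightarrow> (varrho j * exp (deriv ell 1)) ^ l)) \<and>
         (\<forall>\<epsilon>>0. (\<lambda>m. measure (P m) {\<omega> \<in> space (P m).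
              \<bar>monomers m (f m) (L m) \<omega> / real m - \<kappa>bar * exp (deriv ell 1)\<bar> > \<epsilon>}) \<longlonglongrightarrow> 0) \<and>
         ell field_differentiable (at 1) \<and>
         - deriv ell 1 \<ge> 0 \<and>
         \<Lambda> field_differentiable (at (- deriv ell 1)) \<and>
         1 + deriv \<Lambda> (- deriv ell 1) = 0"
proof -
  interpret filament_model K f \<kappa> varkappa varrho by (rule model)
  have \<kappa>1: "\<kappa> m 1 > 0" if "m \<ge> 1" for m
    using kappa_pos[OF that, of 1] filaments[OF that] by simp
  have \<rho>: "0 < \<kappa> m 1 / \<kappa> m n \<and> \<kappa> m 1 / \<kappa> m n < 1"
    if m: "m \<ge> 1" and n: "n \<in> {class_size f \<kappa> varkappa m 1<..f m}" for m n
  proof -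
    obtain j where j: "j \<in> {2..K}" "\<kappa> m n = varkappa m j"
      using n unfolding other_classes[OF m] by blast
    then show ?thesis
      using varrho_bounds[OF j(1)] ratios[OF m, of j] kappa_first[OF m] by simp
  qed
  have "\<forall>\<^sub>F m in sequentially. (\<integral>\<omega>. real (AM m \<omega>) \<partial>Q m) / real m = \<kappa> m 1 / real m"
    using eventually_ge_at_top[of "1::nat"]
    by eventually_elim (simp add: auxiliary_variables.mean_poisson[OF aux \<kappa>1])
  then have kappa_lim: "(\<lambda>m. \<kappa> m 1 / real m) \<longlonglongrightarrow> \<kappa>bar"
    by (rule Lim_transform_eventually[OF mean_M])
  have "\<forall>\<^sub>F m in sequentially. (\<integral>\<omega>. S m \<omega> \<partial>Q m) / real m
      = (\<Sum>j=2..K. real (class_size f \<kappa> varkappa m j) / real m * (varrho j / (1 - varrho j)))"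
    using eventually_ge_at_top[of "1::nat"]
  proof eventually_elim
    case (elim m)
    have "(\<integral>\<omega>. S m \<omega> \<partial>Q m)
        = (\<Sum>n\<in>{class_size f \<kappa> varkappa m 1<..f m}. (\<kappa> m 1 / \<kappa> m n) / (1 - \<kappa> m 1 / \<kappa> m n))"
      unfolding S_eq by (rule auxiliary_variables.mean_aux_sum[OF aux[OF elim] \<rho>[OF elim]])
    also have "\<dots> = (\<Sum>j=2..K. real (class_size f \<kappa> varkappa m j) * (varrho j / (1 - varrho j)))"
      by (rule sum_other_classes[OF elim])
    finally have S: "(\<integral>\<omega>. S m \<omega> \<partial>Q m)
        = (\<Sum>j=2..K. real (class_size f \<kappa> varkappa m j) * (varrho j / (1 - varrho j)))" .
    show ?case
      unfolding S sum_divide_distrib by (intro sum.cong refl) simp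
  qed
  then have "(\<lambda>m. \<Sum>j=2..K. real (class_size f \<kappa> varkappa m j) / real m * (varrho j / (1 - varrho j)))
      \<longlonglongrightarrow> sbar"
    by (rule Lim_transform_eventually[OF mean_S])
  moreover have "(\<lambda>m. \<Sum>j=2..K. real (class_size f \<kappa> varkappa m j) / real m * (varrho j / (1 - varrho j)))
      \<longlonglongrightarrow> (\<Sum>j=2..K. fbar j * (varrho j / (1 - varrho j)))"
    by (intro tendsto_intros class_fractions)
  \<comment> \<open>Uniqueness of limits expresses \<open>sbar\<close> through the class fractions,
    turning the condition on means into the supercriticality of
    \<open>filament_limit\<close>.\<close>
  ultimately have sbar: "sbar = (\<Sum>j=2..K. fbar j * (varrho j / (1 - varrho j)))"
    by (rule LIMSEQ_unique)
  interpret filament_limit K f \<kappa> varkappa varrho fbar \<kappa>bar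
    by unfold_locales
      (use first_class_small kappa_lim \<kappa>bar_nonneg class_fractions fbar_nonneg supercritical sbar in auto)
  obtain x where x: "0 < x" "x < 1" "g x = 1" using ex_root_g by blast
  have \<Lambda>: "\<Lambda> \<theta> = limit_log_laplace \<theta>" if "\<theta> \<ge> 0" for \<theta>
    unfolding \<Lambda>_eq S_eq limit_log_laplace_def
    by (rule log_laplace_closed_form(2)[OF aux kappa_lim class_fractions that])
  note derivs = rate_function_limit_deriv[OF \<Lambda> x]
  have ell: "deriv ell 1 = ln x" unfolding ell_eq by (rule DERIV_imp_deriv[OF derivs(2)])
  have \<Lambda>': "deriv \<Lambda> (- ln x) = - 1" by (rule DERIV_imp_deriv[OF derivs(1)])
  \<comment> \<open>The root x is the constant of the statement, so the limits proved for x apply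
    after rewriting.\<close>
  have exp_ell: "exp (deriv ell 1) = x" using x by (simp add: ell)
  show ?thesis
    unfolding exp_ell
  proof (intro conjI ballI allI impI)
    show "ell field_differentiable (at 1)"
      using derivs(2) unfolding ell_eq field_differentiable_def by blast
    show "\<Lambda> field_differentiable (at (- deriv ell 1))"
      using derivs(1) unfolding ell field_differentiable_def by blast
    show "- deriv ell 1 \<ge> 0" "1 + deriv \<Lambda> (- deriv ell 1) = 0"
      using x by (simp_all add: ell \<Lambda>')
  qed (intro length_tail_limit[OF x lengths] monomers_limit[OF x lengths]; blast)+
qed

end
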